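(* Let $-\infty<a<b<+\infty$ and $I=[a,b]$. Let $f\in C(I\times[0,+\infty),\mathbb R)$ satisfy $f(t,0)=0$ for all $t\in I$, and let $\beta\in C(I,[0,+\infty))$ be such that $f(t,s)\ge-\beta(t)s$ for all $(t,s)\in I\times[0,+\infty)$. Assume the following two conditions. (i) There exists $m_0\in C(I,[0,+\infty))$, $m_0\not\equiv0$, such that $$\lim_{s\to0^+}\max_{t\in I}\left|\frac{f(t,s)+\beta(t)s}{s}-m_0(t)\right|=0\qquad\text{and}\qquad\lambda_1(m_0)<1.$$ (ii) There exists $m_\infty\in C(I,\mathbb R)$ such that $$\limsup_{s\to+\infty}\max_{t\in I}\left[\frac{f(t,s)}{s}-m_\infty(t)\right]\le0\qquad\text{and}\qquad\mu_1(m_\infty^+)>1,$$ where $m_\infty^+(t)=\max\{m_\infty(t),0\}$, and where $\mu_1(m_\infty^+):=+\infty$ if $m_\infty^+\equiv0$. Then the problem $$-\left(\frac{u'(t)}{\sqrt{1-(u'(t))^2}}\right)'=f(t,u(t)),\quad t\in(a,b),\qquad u'(a)=0,\quad u(b)=0,$$ has at least one positive solution $u$, and $\|u'\|_\infty<1$.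
   Context: $\|\cdot\|_\infty$ is the maximum norm on $I=[a,b]$. Let $\varphi(s)=s/\sqrt{1-s^2}$ for $|s|<1$. A solution of the boundary value problem is a function $u\in C^1(I)$ such that $\|u'\|_\infty<1$, $\varphi(u')\in C^1(I)$, and the equation and boundary conditions hold. It is called positive if $u(t)>0$ for $a\le t<b$ and $u(b)=0$. For $c\in C(I,[0,+\infty))$, $c\not\equiv0$, $\lambda_1(c)$ denotes the principal (smallest) eigenvalue $\lambda$ of $$-e''+\beta(t)e=\lambda c(t)e\ \text{ on }(a,b),\qquad e'(a)=0,\quad e(b)=0,$$ where $\beta$ is the fixed function in the claim; equivalently, $$\lambda_1(c)=\inf\left\{\frac{\int_a^b\bigl((v')^2+\beta v^2\bigr)\,dt}{\int_a^b c\,v^2\,dt}:\ v\in H^1(a,b),\ v(b)=0,\ \int_a^b c\,v^2\,dt>0\right\}.$$ $\mu_1(c)$ denotes the principal eigenvalue of the same problem with $\beta$ replaced by $0$, i.e. of $-e''=\mu c(t)e$ on $(a,b)$, $e'(a)=0$, $e(b)=0$ (equivalently, the same infimum with $\beta\equiv0$). *)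

theory Defs
  imports "HOL-Analysis.Analysis"
begin

text \<open>Functions on \<open>[a, b]\<close> are total functions of which only the values on
  \<^term>\<open>{a..b}\<close> matter. Derivatives are taken within \<^term>\<open>{a..b}\<close>, so they are
  one-sided at the endpoints; for \<open>a < b\<close> they are unique.\<close>

definition deriv_on :: "real \<Rightarrow> real \<Rightarrow> (real \<Rightarrow> real) \<Rightarrow> real \<Rightarrow> real" where
  "deriv_on a b u t = vector_derivative u (at t within {a..b})"

definition C1_on :: "real \<Rightarrow> real \<Rightarrow> (real \<Rightarrow> real) \<Rightarrow> bool" where
  "C1_on a b u \<longleftrightarrow> u differentiable_on {a..b} \<and> continuous_on {a..b} (deriv_on a b u)"

text \<open>Only applied to continuous functions and nonempty intervals, where the supremum
  is a maximum.\<close>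

definition max_norm :: "real \<Rightarrow> real \<Rightarrow> (real \<Rightarrow> real) \<Rightarrow> real" where
  "max_norm a b v = (SUP t\<in>{a..b}. \<bar>v t\<bar>)"

definition phi :: "real \<Rightarrow> real" where
  "phi s = s / sqrt (1 - s\<^sup>2)"

definition is_solution :: "real \<Rightarrow> real \<Rightarrow> (real \<Rightarrow> real \<Rightarrow> real) \<Rightarrow> (real \<Rightarrow> real) \<Rightarrow> bool" where
  "is_solution a b f u \<longleftrightarrow>
     C1_on a b u \<and>
     max_norm a b (deriv_on a b u) < 1 \<and>
     C1_on a b (\<lambda>t. phi (deriv_on a b u t)) \<and>
     (\<forall>t\<in>{a<..<b}. - deriv_on a b (\<lambda>s. phi (deriv_on a b u s)) t = f t (u t)) \<and>
     deriv_on a b u a = 0 \<and> u b = 0"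

definition positive_solution ::
  "real \<Rightarrow> real \<Rightarrow> (real \<Rightarrow> real \<Rightarrow> real) \<Rightarrow> (real \<Rightarrow> real) \<Rightarrow> bool" where
  "positive_solution a b f u \<longleftrightarrow>
     is_solution a b f u \<and> (\<forall>t\<in>{a..<b}. u t > 0) \<and> u b = 0"

text \<open>\<open>l\<close> is an eigenvalue of \<open>- e'' + \<beta> e = l c e\<close> on \<open>(a, b)\<close>, \<open>e' a = 0\<close>, \<open>e b = 0\<close>.
  Eigenfunctions are classical; for continuous \<open>\<beta>\<close> and \<open>c\<close> they are \<open>C\<^sup>2\<close> up to the
  boundary.\<close>

definition is_eigenvalue ::
  "real \<Rightarrow> real \<Rightarrow> (real \<Rightarrow> real) \<Rightarrow> (real \<Rightarrow> real) \<Rightarrow> real \<Rightarrow> bool" where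
  "is_eigenvalue a b \<beta> c l \<longleftrightarrow>
     (\<exists>e. C1_on a b e \<and>
        (\<forall>t\<in>{a<..<b}. deriv_on a b e differentiable (at t) \<and>
           - deriv (deriv_on a b e) t + \<beta> t * e t = l * c t * e t) \<and>
        deriv_on a b e a = 0 \<and> e b = 0 \<and> (\<exists>t\<in>{a..b}. e t \<noteq> 0))"

text \<open>The smallest eigenvalue. For continuous \<open>c \<ge> 0\<close> that is not identically zero and
  continuous \<open>\<beta> \<ge> 0\<close> it exists by Sturm-Liouville theory, so that the infimum is attained
  and finite.\<close>

definition principal_eigenvalue ::
  "real \<Rightarrow> real \<Rightarrow> (real \<Rightarrow> real) \<Rightarrow> (real \<Rightarrow> real) \<Rightarrow> ereal" where
  "principal_eigenvalue a b \<beta> c = Inf {ereal l |l. is_eigenvalue a b \<beta> c l}"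

definition lambda1 :: "real \<Rightarrow> real \<Rightarrow> (real \<Rightarrow> real) \<Rightarrow> (real \<Rightarrow> real) \<Rightarrow> ereal" where
  "lambda1 a b \<beta> c = principal_eigenvalue a b \<beta> c"

definition mu1 :: "real \<Rightarrow> real \<Rightarrow> (real \<Rightarrow> real) \<Rightarrow> ereal" where
  "mu1 a b c =
     (if \<forall>t\<in>{a..b}. c t = 0 then \<infinity> else principal_eigenvalue a b (\<lambda>_. 0) c)"

end

theory Submission
  imports Defs "HOL-Complex_Analysis.Great_Picard"
begin

text \<open>The solution is found by minimising the action
  \<open>J(p) = integral over [a, b] of Phi(p) - G(t, u)\<close>, where \<open>u\<close> is the primitive of \<open>p\<close> with
  \<open>u(b) = 0\<close>, \<open>Phi(s) = 1 - sqrt(1 - s\<^sup>2)\<close> is the antiderivative of \<open>phi\<close>, and \<open>G(t, \<cdot>)\<close> is the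
  antiderivative of \<open>f(t, \<cdot>)\<close>, extended by \<open>0\<close> to negative arguments. The competitors are the
  continuous \<open>p\<close> with \<open>\<bar>p\<bar> \<le> 1\<close>, so all \<open>u\<close> are bounded by \<open>b - a\<close> and \<open>J\<close> is bounded below
  whatever the growth of \<open>f\<close> at infinity.

  The primitives of a minimising sequence converge uniformly along a subsequence, by
  Arzela-Ascoli, to some \<open>U\<close>. The explicit solution \<open>w\<close> of \<open>- phi(w')' = f(t, U)\<close> with the given
  boundary conditions minimises the convex functional that has \<open>f(t, U) u\<close> in place of
  \<open>G(t, u)\<close>. Since \<open>Phi'' \<ge> 1\<close>, an element \<open>p\<close> of the sequence that stays away from \<open>w'\<close> in mean
  square could be improved by a fixed amount by moving it towards \<open>w'\<close>
  (\<open>near_minimiser_close_to_response\<close>). Hence \<open>U = w\<close>, which makes \<open>U\<close> a solution with \<open>\<bar>U'\<bar> < 1\<close>;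
  the minimiser never has to be differentiated almost everywhere.

  If \<open>J\<close> takes a negative value, then \<open>U\<close> is not zero (\<open>exists_nontrivial_critical_point\<close>).
  Near \<open>0\<close> the action behaves like half of the quadratic form
  \<open>integral of u'\<^sup>2 + (\<beta> - m0) u\<^sup>2\<close>, which is negative at an eigenfunction with eigenvalue below
  \<open>1\<close>; smoothing its absolute value gives a nonnegative test function
  (\<open>nonneg_negative_energy\<close>, \<open>exists_negative_action\<close>). The extension of \<open>f\<close> by \<open>0\<close> forces
  \<open>U \<ge> 0\<close> (\<open>fixed_point_nonneg\<close>), and \<open>f(t, s) \<ge> - \<beta>(t) s\<close> gives the strong maximum principle
  \<open>fixed_point_zero\<close>, so that \<open>U\<close> is positive on \<open>[a, b)\<close>.\<close>

section \<open>The relativistic operator and its potential\<close>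

text \<open>The inverse of \<open>phi\<close>, a bijection from the real line onto \<open>(-1, 1)\<close>.\<close>

definition psi :: "real \<Rightarrow> real" where
  "psi y = y / sqrt (1 + y\<^sup>2)"

text \<open>The antiderivative of \<open>phi\<close> that vanishes at \<open>0\<close>. It is bounded and convex on \<open>[-1, 1]\<close>.\<close>

definition Phi :: "real \<Rightarrow> real" where
  "Phi s = 1 - sqrt (1 - s\<^sup>2)"

lemma one_plus_sq_pos [simp]: "1 + (y::real)\<^sup>2 > 0"
  by (simp add: add_pos_nonneg)

lemma sqrt_one_plus_sq_pos: "sqrt (1 + (y::real)\<^sup>2) > 0"
  by simp

lemma continuous_on_psi [continuous_intros]:
  "continuous_on S y \<Longrightarrow> continuous_on S (\<lambda>t. psi (y t))"
  unfolding psi_def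
  by (intro continuous_intros) (use sqrt_one_plus_sq_pos in \<open>auto simp: less_le\<close>)

lemma continuous_on_Phi [continuous_intros]:
  "continuous_on S p \<Longrightarrow> continuous_on S (\<lambda>t. Phi (p t))"
  unfolding Phi_def by (intro continuous_intros)

lemma one_minus_psi_sq: "1 - (psi y)\<^sup>2 = (1 / sqrt (1 + y\<^sup>2))\<^sup>2"
proof -
  have "1 + y\<^sup>2 \<noteq> 0" using one_plus_sq_pos[of y] by linarith
  then show ?thesis
    by (simp add: psi_def power_divide field_simps)
qed

lemma abs_psi_less_1: "\<bar>psi y\<bar> < 1"
proof -
  have "(psi y)\<^sup>2 < 1"
    using one_minus_psi_sq[of y] sqrt_one_plus_sq_pos[of y]
    by (metis diff_gt_0_iff_gt zero_less_divide_1_iff zero_less_power)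
  then show ?thesis by (simp add: abs_square_less_1)
qed

lemma phi_psi: "phi (psi y) = y"
proof -
  have "sqrt (1 - (psi y)\<^sup>2) = 1 / sqrt (1 + y\<^sup>2)"
    using sqrt_one_plus_sq_pos[of y] by (simp add: one_minus_psi_sq real_sqrt_divide real_sqrt_abs)
  then show ?thesis
    using one_plus_sq_pos[of y] by (simp add: phi_def psi_def less_le)
qed

lemma psi_phi:
  assumes "\<bar>s\<bar> < 1"
  shows "psi (phi s) = s"
proof -
  have p: "1 - s\<^sup>2 > 0" using assms by (simp add: abs_square_less_1)
  then have "1 + (phi s)\<^sup>2 = 1 / (1 - s\<^sup>2)"
    by (simp add: phi_def power_divide field_simps)
  then show ?thesis
    using p by (simp add: psi_def phi_def real_sqrt_divide)
qed

lemma psi_0 [simp]: "psi 0 = 0"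
  by (simp add: psi_def)

lemma psi_nonpos: "y \<le> 0 \<Longrightarrow> psi y \<le> 0"
  unfolding psi_def by (rule divide_nonpos_pos[OF _ sqrt_one_plus_sq_pos])

lemma abs_psi_le: "\<bar>psi y\<bar> \<le> \<bar>y\<bar>"
proof -
  have "sqrt (1 + y\<^sup>2) \<ge> 1" by simp
  then have "\<bar>y\<bar> / sqrt (1 + y\<^sup>2) \<le> \<bar>y\<bar> / 1"
    by (intro divide_left_mono) auto
  then show ?thesis
    by (simp add: psi_def abs_divide)
qed

lemma psi_le_of_le:
  assumes "y \<le> z" "0 \<le> z"
  shows "psi y \<le> z"
  using abs_psi_le[of y] psi_nonpos[of y] assms by linarith

lemma psi_minus: "psi (- y) = - psi y"
  by (simp add: psi_def)

lemma Phi_nonneg: "\<bar>s\<bar> \<le> 1 \<Longrightarrow> 0 \<le> Phi s"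
  by (simp add: Phi_def)

text \<open>Uniform convexity: the second derivative of \<open>Phi\<close> is at least \<open>1\<close>. Here \<open>y\<close> is the slope
  of \<open>Phi\<close> at \<open>psi y\<close>, and \<open>x\<close> may be an endpoint of \<open>[-1, 1]\<close>.\<close>

lemma Phi_uniformly_convex:
  assumes "\<bar>x\<bar> \<le> 1"
  shows "(x - psi y)\<^sup>2 / 2 \<le> Phi x - Phi (psi y) - y * (x - psi y)"
proof -
  define c where "c = 1 / sqrt (1 + y\<^sup>2)"
  define q where "q = psi y"
  define d where "d = sqrt (1 - x\<^sup>2)"
  have c0: "c > 0" using sqrt_one_plus_sq_pos[of y] by (simp add: c_def)
  have qc: "q = y * c" by (simp add: q_def psi_def c_def)
  have sq: "q\<^sup>2 + c\<^sup>2 = 1" using one_minus_psi_sq[of y] by (simp add: q_def c_def)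
  have c1: "c \<le> 1"
    using sq c0 by (smt (verit) one_power2 power2_le_imp_le zero_le_power2)
  have dsq: "d\<^sup>2 = 1 - x\<^sup>2"
    using assms by (simp add: d_def abs_square_le_1)
  have Phiq: "Phi q = 1 - c"
  proof -
    have "1 - q\<^sup>2 = c\<^sup>2" using sq by simp
    then show ?thesis using c0 by (simp add: Phi_def)
  qed
  have Phix: "Phi x = 1 - d" by (simp add: Phi_def d_def)
  \<comment> \<open>half the squared chord between two points of the unit circle\<close>
  have "c * (Phi x - Phi q - y * (x - q)) = c\<^sup>2 - c * d - q * x + q\<^sup>2"
    unfolding Phiq Phix by (simp add: qc power2_eq_square algebra_simps)
  also have "\<dots> = ((x - q)\<^sup>2 + (c - d)\<^sup>2) / 2"
    using sq dsq by (simp add: power2_eq_square algebra_simps)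
  also have "\<dots> \<ge> c * ((x - q)\<^sup>2 / 2)"
    using c1 c0 mult_right_mono[of c 1 "(x - q)\<^sup>2 / 2"] by (simp add: add_increasing2)
  finally show ?thesis
    using c0 by (simp add: q_def)
qed

text \<open>Only \<open>p\<close> may have modulus \<open>1\<close>: then \<open>s > 0\<close> keeps the combination inside \<open>(-1, 1)\<close>, where
  \<^const>\<open>Phi\<close> has a tangent.\<close>

lemma Phi_convex_combination:
  assumes p: "\<bar>p\<bar> \<le> 1" and q: "\<bar>q\<bar> < 1" and s: "0 < s" "s \<le> 1"
  shows "Phi ((1 - s) * p + s * q) \<le> (1 - s) * Phi p + s * Phi q"
proof -
  define z where "z = (1 - s) * p + s * q"
  have "\<bar>z\<bar> \<le> (1 - s) * \<bar>p\<bar> + s * \<bar>q\<bar>"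
    unfolding z_def using s by (metis abs_triangle_ineq abs_mult abs_of_nonneg diff_ge_0_iff_ge less_imp_le)
  also have "\<dots> < (1 - s) * 1 + s * 1"
    using p q s by (intro add_le_less_mono mult_left_mono mult_strict_left_mono) auto
  finally have z: "\<bar>z\<bar> < 1" by simp
  have zz: "psi (phi z) = z" by (rule psi_phi[OF z])
  have tangent: "Phi z + phi z * (x - z) \<le> Phi x" if "\<bar>x\<bar> \<le> 1" for x
    using Phi_uniformly_convex[OF that, of "phi z"] unfolding zz
    by (smt (verit) zero_le_power2 field_sum_of_halves)
  have "(1 - s) * (Phi z + phi z * (p - z)) + s * (Phi z + phi z * (q - z))
      \<le> (1 - s) * Phi p + s * Phi q"
    using s p q by (intro add_mono mult_left_mono tangent) auto
  moreover have "(1 - s) * (Phi z + phi z * (p - z)) + s * (Phi z + phi z * (q - z)) = Phi z"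
  proof -
    have "(1 - s) * (Phi z + phi z * (p - z)) + s * (Phi z + phi z * (q - z))
        = Phi z + phi z * (((1 - s) * p + s * q) - z)" by (simp add: algebra_simps)
    then show ?thesis by (simp add: z_def)
  qed
  ultimately show ?thesis by (simp add: z_def)
qed

lemma Phi_le_quartic:
  assumes "\<bar>x\<bar> \<le> 1"
  shows "Phi x \<le> x\<^sup>2 / 2 + x ^ 4 / 2"
proof -
  define c where "c = sqrt (1 - x\<^sup>2)"
  have c: "0 \<le> c" "c \<le> 1" and c2: "c\<^sup>2 = 1 - x\<^sup>2"
    using assms by (auto simp: c_def abs_square_le_1)
  have x2: "x\<^sup>2 = 1 - c\<^sup>2" using c2 by simp
  have x4: "x ^ 4 = (1 - c\<^sup>2)\<^sup>2" using x2 by (metis power_mult[of x 2 2] mult_2 numeral_Bit0)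
  have Phix: "Phi x = 1 - c" by (simp add: Phi_def c_def)
  have "x\<^sup>2 / 2 + x ^ 4 / 2 - Phi x = c * (1 - c)\<^sup>2 * (2 + c) / 2"
    unfolding x4 x2 Phix by (simp add: power2_eq_square field_simps)
  moreover have "c * (1 - c)\<^sup>2 * (2 + c) / 2 \<ge> 0" using c by simp
  ultimately show ?thesis by linarith
qed

section \<open>Primitives vanishing at the right endpoint\<close>

text \<open>The primitive of \<open>p\<close> on an interval ending at \<open>b\<close> that vanishes at \<open>b\<close>.\<close>

definition prim :: "real \<Rightarrow> (real \<Rightarrow> real) \<Rightarrow> real \<Rightarrow> real" where
  "prim b p t = - integral {t..b} p"

lemma prim_right [simp]: "prim b p b = 0"
  by (simp add: prim_def)

lemma prim_has_derivative:
  assumes "continuous_on {a..b} p" "t \<in> {a..b}"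
  shows "(prim b p has_real_derivative p t) (at t within {a..b})"
  using DERIV_minus[OF integral_has_real_derivative'[OF assms]] by (simp add: prim_def[abs_def])

lemma continuous_on_prim:
  "continuous_on {a..b} p \<Longrightarrow> continuous_on {a..b} (prim b p)"
  by (meson DERIV_continuous_on prim_has_derivative)

lemma integrable_on_tail:
  assumes "continuous_on {a..b} (p :: real \<Rightarrow> real)" "t \<in> {a..b}"
  shows "p integrable_on {t..b}"
  by (rule integrable_continuous_real) (use assms in \<open>auto intro: continuous_on_subset\<close>)

lemma prim_combination:
  assumes "continuous_on {a..b} p" "continuous_on {a..b} q" "t \<in> {a..b}"
  shows "prim b (\<lambda>t. (1 - s) * p t + s * q t) t = prim b p t + s * (prim b q t - prim b p t)"
proof -
  note i = integrable_on_tail[OF assms(1,3)] integrable_on_tail[OF assms(2,3)]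
  have "integral {t..b} (\<lambda>t. (1 - s) * p t + s * q t)
      = (1 - s) * integral {t..b} p + s * integral {t..b} q"
    using i by (subst integral_add) (auto intro: integrable_on_mult_right)
  then show ?thesis by (simp add: prim_def algebra_simps)
qed

lemma prim_diff:
  assumes "continuous_on {a..b} p" "continuous_on {a..b} q" "t \<in> {a..b}"
  shows "prim b p t - prim b q t = prim b (\<lambda>t. p t - q t) t"
  using integrable_on_tail[OF assms(1,3)] integrable_on_tail[OF assms(2,3)]
  by (simp add: prim_def integral_diff)

lemma prim_eq_of_derivative:
  assumes "\<And>t. t \<in> {a..b} \<Longrightarrow> (v has_real_derivative v' t) (at t within {a..b})"
    and "v b = 0" "t \<in> {a..b}"
  shows "prim b v' t = v t"
proof -
  have "(v has_real_derivative v' x) (at x within {t..b})" if "x \<in> {t..b}" for x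
    by (rule DERIV_subset[OF assms(1)]) (use that assms(3) in auto)
  then have "(v' has_integral (v b - v t)) {t..b}"
    using assms(3) by (intro fundamental_theorem_of_calculus)
       (auto simp: has_real_derivative_iff_has_vector_derivative[symmetric])
  then show ?thesis using assms(2) by (simp add: prim_def integral_unique)
qed

lemma abs_prim_le:
  assumes "continuous_on {a..b} p" "t \<in> {a..b}" "\<And>t. t \<in> {a..b} \<Longrightarrow> \<bar>p t\<bar> \<le> 1"
  shows "\<bar>prim b p t\<bar> \<le> b - a"
proof -
  have "norm (integral {t..b} p) \<le> 1 * (b - t)"
    using assms by (intro integral_bound) (auto intro: continuous_on_subset)
  then show ?thesis using assms(2) by (simp add: prim_def)
qed

lemma prim_lipschitz:
  assumes "continuous_on {a..b} p" "t \<in> {a..b}" "t' \<in> {a..b}"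
    and "\<And>t. t \<in> {a..b} \<Longrightarrow> \<bar>p t\<bar> \<le> 1"
  shows "\<bar>prim b p t - prim b p t'\<bar> \<le> \<bar>t - t'\<bar>"
proof -
  have "norm (prim b p t - prim b p t') \<le> 1 * norm (t - t')"
    by (rule field_differentiable_bound[of "{a..b}" "prim b p" p])
       (use assms prim_has_derivative in auto)
  then show ?thesis by simp
qed

text \<open>Cauchy-Schwarz in additive form; the free parameter \<open>c\<close> avoids square roots of integrals.\<close>

lemma abs_prim_le_L2:
  assumes p: "continuous_on {a..b} p" and t: "t \<in> {a..b}" and c: "c > 0"
  shows "\<bar>prim b p t\<bar> \<le> c * (b - a) / 2 + integral {a..b} (\<lambda>t. (p t)\<^sup>2) / (2 * c)"
proof -
  have pc: "continuous_on {t..b} p" using p t by (auto intro: continuous_on_subset)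
  have am_gm: "\<bar>x\<bar> \<le> c / 2 + x\<^sup>2 / (2 * c)" for x :: real
  proof -
    have "0 \<le> (\<bar>x\<bar> - c)\<^sup>2 / (2 * c)" using c by simp
    also have "\<dots> = c / 2 + x\<^sup>2 / (2 * c) - \<bar>x\<bar>"
      using c by (simp add: power2_eq_square field_simps)
    finally show ?thesis by simp
  qed
  have "\<bar>prim b p t\<bar> = norm (integral {t..b} p)"
    by (simp add: prim_def)
  also have "\<dots> \<le> integral {t..b} (\<lambda>t. c / 2 + (p t)\<^sup>2 / (2 * c))"
    by (rule integral_norm_bound_integral)
       (use pc c am_gm in \<open>auto intro!: integrable_continuous_real continuous_intros\<close>)
  also have "\<dots> \<le> integral {a..b} (\<lambda>t. c / 2 + (p t)\<^sup>2 / (2 * c))"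
    by (rule integral_subset_le)
       (use p pc t c in \<open>auto intro!: integrable_continuous_real continuous_intros\<close>)
  also have "\<dots> = c * (b - a) / 2 + integral {a..b} (\<lambda>t. (p t)\<^sup>2) / (2 * c)"
    using t p by (subst integral_add)
      (auto intro!: integrable_continuous_real continuous_intros simp: c less_imp_neq[symmetric])
  finally show ?thesis .
qed

lemma integral_by_parts_prim:
  assumes h: "continuous_on {a..b} h" and p: "continuous_on {a..b} p" and ab: "a \<le> b"
  shows "integral {a..b} (\<lambda>t. h t * prim b p t) = integral {a..b} (\<lambda>t. - integral {a..t} h * p t)"
proof -
  let ?y = "\<lambda>t. - integral {a..t} h"
  have y': "(?y has_real_derivative - h t) (at t within {a..b})" if "t \<in> {a..b}" for t
    using DERIV_minus[OF integral_has_real_derivative[OF h that]] .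
  have yc: "continuous_on {a..b} ?y" by (rule DERIV_continuous_on[OF y'])
  have "((\<lambda>t. ?y t * prim b p t) has_real_derivative - h t * prim b p t + p t * ?y t)
      (at t within {a..b})" if "t \<in> {a..b}" for t
    by (rule DERIV_mult[OF y'[OF that] prim_has_derivative[OF p that]])
  then have "((\<lambda>t. - h t * prim b p t + p t * ?y t) has_integral
      (?y b * prim b p b - ?y a * prim b p a)) {a..b}"
    using ab unfolding has_real_derivative_iff_has_vector_derivative
    by (rule fundamental_theorem_of_calculus[rotated])
  moreover have "(\<lambda>t. - h t * prim b p t + p t * ?y t) = (\<lambda>t. ?y t * p t - h t * prim b p t)"
    by (rule ext) simp
  ultimately have 0: "integral {a..b} (\<lambda>t. ?y t * p t - h t * prim b p t) = 0"
    by (simp add: integral_unique)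
  have "integral {a..b} (\<lambda>t. ?y t * p t - h t * prim b p t)
      = integral {a..b} (\<lambda>t. ?y t * p t) - integral {a..b} (\<lambda>t. h t * prim b p t)"
    by (rule integral_diff; intro integrable_continuous_real continuous_on_mult yc p h continuous_on_prim)
  then show ?thesis using 0 by simp
qed

section \<open>The action functional\<close>

text \<open>The unknown of the variational problem is the derivative \<open>p\<close> of a function
  \<^term>\<open>prim b p\<close>; the constraint \<open>\<bar>p\<bar> \<le> 1\<close> is convex, and convex combinations of derivatives
  correspond to convex combinations of primitives.\<close>

locale action_functional =
  fixes a b :: real and g :: "real \<Rightarrow> real \<Rightarrow> real"
  assumes ab: "a < b" and g_cont: "continuous_on ({a..b} \<times> UNIV) (\<lambda>(t, s). g t s)"
begin

text \<open>The competing slopes. Slopes of modulus \<open>1\<close> are included, where \<^const>\<open>Phi\<close> is still finite.\<close>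

definition admissible :: "(real \<Rightarrow> real) \<Rightarrow> bool" where
  "admissible p \<longleftrightarrow> continuous_on {a..b} p \<and> (\<forall>t\<in>{a..b}. \<bar>p t\<bar> \<le> 1)"

text \<open>The primitive of \<open>g t\<close> vanishing at \<open>0\<close>, written as an integral over a fixed interval so
  that no orientation is needed for \<open>s < 0\<close>.\<close>

definition G :: "real \<Rightarrow> real \<Rightarrow> real" where
  "G t s = integral {0..1} (\<lambda>r. s * g t (r * s))"

text \<open>The Lagrangian action of \<^term>\<open>prim b p\<close>, as a function of its derivative \<open>p\<close>.\<close>

definition action :: "(real \<Rightarrow> real) \<Rightarrow> real" where
  "action p = integral {a..b} (\<lambda>t. Phi (p t) - G t (prim b p t))"

lemma continuous_on_g [continuous_intros]:
  assumes "continuous_on S x" "continuous_on S y" "\<And>z. z \<in> S \<Longrightarrow> x z \<in> {a..b}"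
  shows "continuous_on S (\<lambda>z. g (x z) (y z))"
  using continuous_on_compose2[OF g_cont continuous_on_Pair[OF assms(1,2)]] assms(3)
  by (simp add: image_subset_iff)

lemma continuous_on_G:
  assumes "continuous_on {a..b} u"
  shows "continuous_on {a..b} (\<lambda>t. G t (u t))"
proof -
  have u2: "continuous_on ({a..b} \<times> {0..1::real}) (\<lambda>x. u (fst x))"
    by (rule continuous_on_compose2[OF assms]) (auto intro!: continuous_intros)
  have "continuous_on ({a..b} \<times> cbox 0 1) (\<lambda>(t, r). u t * g t (r * u t))"
    unfolding case_prod_beta cbox_interval
    by (rule continuous_on_mult[OF u2] continuous_on_g continuous_intros u2)+ auto
  from integral_continuous_on_param[OF this] show ?thesis
    by (simp add: G_def)
qed

lemma G_has_derivative:
  assumes t: "t \<in> {a..b}"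
  shows "(G t has_real_derivative g t s) (at s)"
proof -
  define R where "R = \<bar>s\<bar> + 1"
  define P where "P = (\<lambda>x. integral {-R..x} (g t))"
  have gc: "continuous_on S (g t)" for S
    by (rule continuous_on_g) (use t in \<open>auto intro: continuous_intros\<close>)
  have P': "(P has_real_derivative g t x) (at x within {-R..R})" if "x \<in> {-R..R}" for x
    unfolding P_def by (rule integral_has_real_derivative[OF gc that])
  have G_eq: "G t x = P x - P 0" if x: "x \<in> {-R..R}" for x
  proof -
    have "((\<lambda>r. P (r * x)) has_real_derivative x * g t (r * x)) (at r within {0..1})"
      if r: "r \<in> {0..1}" for r
    proof -
      have in_R: "r * x \<in> {-R..R}" if "r \<in> {0..1}" for r
      proof -
        have "\<bar>r * x\<bar> \<le> 1 * \<bar>x\<bar>" unfolding abs_mult using that by (intro mult_right_mono) auto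
        then show ?thesis using x by auto
      qed
      have "(P has_real_derivative g t (r * x)) (at (r * x) within (\<lambda>r. r * x) ` {0..1})"
        by (rule DERIV_subset[OF P'[OF in_R[OF r]]]) (use in_R in auto)
      moreover have "((\<lambda>r. r * x) has_real_derivative x) (at r within {0..1})"
        by (auto intro!: derivative_eq_intros)
      ultimately have "(P \<circ> (\<lambda>r. r * x) has_real_derivative g t (r * x) * x) (at r within {0..1})"
        by (rule DERIV_image_chain)
      then show ?thesis
        by (simp add: o_def mult.commute)
    qed
    then have "((\<lambda>r. x * g t (r * x)) has_integral (P (1 * x) - P (0 * x))) {0..1}"
      by (intro fundamental_theorem_of_calculus)
         (auto simp: has_real_derivative_iff_has_vector_derivative[symmetric])
    from integral_unique[OF this] show ?thesis by (simp add: G_def)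
  qed
  have s: "s \<in> {-R<..<R}" by (auto simp: R_def)
  have "(P has_real_derivative g t s) (at s)"
    using P'[of s] s by (simp add: at_within_Icc_at)
  then have "((\<lambda>x. P x - P 0) has_real_derivative g t s) (at s)"
    by (auto intro!: derivative_eq_intros)
  then show ?thesis
    by (rule has_field_derivative_transform_within_open[where S = "{-R<..<R}"]) (use s G_eq in auto)
qed

lemma G_0 [simp]: "G t 0 = 0"
  by (simp add: G_def)

lemma G_mean_value:
  assumes "t \<in> {a..b}"
  obtains \<xi> where "G t s' - G t s = (s' - s) * g t \<xi>" "\<bar>\<xi> - s\<bar> \<le> \<bar>s' - s\<bar>"
proof (cases s s' rule: linorder_cases)
  case less
  then obtain \<xi> where "\<xi> > s" "\<xi> < s'" "G t s' - G t s = (s' - s) * g t \<xi>"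
    using MVT2[OF less, of "G t" "g t"] G_has_derivative[OF assms] by blast
  then show ?thesis using that[of \<xi>] by auto
next
  case equal
  then show ?thesis using that[of s] by auto
next
  case greater
  then obtain \<xi> where "\<xi> > s'" "\<xi> < s" "G t s - G t s' = (s - s') * g t \<xi>"
    using MVT2[OF greater, of "G t" "g t"] G_has_derivative[OF assms] by blast
  then show ?thesis using that[of \<xi>] by (auto simp: algebra_simps)
qed

lemma continuous_on_action_integrand:
  "admissible p \<Longrightarrow> continuous_on {a..b} (\<lambda>t. Phi (p t) - G t (prim b p t))"
  unfolding admissible_def by (auto intro!: continuous_intros continuous_on_G continuous_on_prim)

lemma g_bounded:
  obtains M where "M > 0" "\<And>t s. t \<in> {a..b} \<Longrightarrow> \<bar>s\<bar> \<le> R \<Longrightarrow> \<bar>g t s\<bar> \<le> M"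
proof -
  have "continuous_on ({a..b} \<times> {-R..R}) (\<lambda>x. g (fst x) (snd x))"
    by (auto intro!: continuous_intros)
  then have "bounded ((\<lambda>x. g (fst x) (snd x)) ` ({a..b} \<times> {-R..R}))"
    by (intro compact_imp_bounded compact_continuous_image compact_Times) auto
  then obtain M where "M > 0" "\<forall>x\<in>({a..b} \<times> {-R..R}). \<bar>g (fst x) (snd x)\<bar> \<le> M"
    unfolding bounded_pos by auto
  then show ?thesis by (intro that[of M]) (auto simp: abs_le_iff)
qed

lemma g_uniformly_continuous:
  assumes "e > 0"
  obtains d where "d > 0"
    "\<And>t s s'. t \<in> {a..b} \<Longrightarrow> \<bar>s\<bar> \<le> R \<Longrightarrow> \<bar>s' - s\<bar> < d \<Longrightarrow> \<bar>g t s' - g t s\<bar> < e"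
proof -
  let ?K = "{a..b} \<times> {-R-1..R+1}"
  have "continuous_on ?K (\<lambda>x. g (fst x) (snd x))"
    by (auto intro!: continuous_intros)
  then have "uniformly_continuous_on ?K (\<lambda>x. g (fst x) (snd x))"
    by (intro compact_uniformly_continuous compact_Times) auto
  then obtain d where d: "d > 0" "\<forall>x\<in>?K. \<forall>x'\<in>?K. dist x' x < d \<longrightarrow>
      dist (g (fst x') (snd x')) (g (fst x) (snd x)) < e"
    unfolding uniformly_continuous_on_def using assms by meson
  show ?thesis
  proof (rule that[of "min d 1"])
    fix t s s' assume *: "t \<in> {a..b}" "\<bar>s\<bar> \<le> R" "\<bar>s' - s\<bar> < min d 1"
    then have "(t, s) \<in> ?K" "(t, s') \<in> ?K" "dist (t, s') (t, s) < d"
      by (auto simp: dist_Pair_Pair dist_real_def)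
    with d(2) show "\<bar>g t s' - g t s\<bar> < e" by (force simp: dist_real_def)
  qed (use d in auto)
qed

section \<open>The minimiser of the action\<close>

text \<open>For fixed \<open>U\<close>, the field \<^term>\<open>\<lambda>t. g t (U t)\<close> is a given load, and the convex functional
  \<open>integral (Phi p - g(t, U) * prim b p)\<close> is minimised by \<^term>\<open>response U\<close>: this is the derivative
  of the solution of \<open>- phi(w')' = g(t, U)\<close>, \<open>w'(a) = 0\<close>, \<open>w(b) = 0\<close>.\<close>

definition response :: "(real \<Rightarrow> real) \<Rightarrow> real \<Rightarrow> real" where
  "response U t = psi (- integral {a..t} (\<lambda>r. g r (U r)))"

lemma continuous_on_load:
  "continuous_on {a..b} U \<Longrightarrow> continuous_on {a..b} (\<lambda>t. g t (U t))"
  by (intro continuous_intros) auto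

lemma momentum_has_derivative:
  assumes "continuous_on {a..b} U" "t \<in> {a..b}"
  shows "((\<lambda>t. - integral {a..t} (\<lambda>r. g r (U r))) has_real_derivative - g t (U t)) (at t within {a..b})"
  by (rule DERIV_minus[OF integral_has_real_derivative[OF continuous_on_load[OF assms(1)] assms(2)]])

lemma continuous_on_momentum:
  "continuous_on {a..b} U \<Longrightarrow> continuous_on {a..b} (\<lambda>t. - integral {a..t} (\<lambda>r. g r (U r)))"
  by (rule DERIV_continuous_on[OF momentum_has_derivative])

lemma continuous_on_response:
  "continuous_on {a..b} U \<Longrightarrow> continuous_on {a..b} (response U)"
  unfolding response_def by (intro continuous_intros continuous_on_momentum)

text \<open>The convex functional with load \<^term>\<open>\<lambda>t. g t (U t)\<close> exceeds its value at the response by at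
  least half the squared mean distance. After integration by parts this is the uniform convexity
  of \<^const>\<open>Phi\<close>, applied with the momentum \<open>phi(w')\<close> of the response \<open>w'\<close> as slope of the tangent.\<close>

lemma load_energy_gap:
  assumes U: "continuous_on {a..b} U" and p: "admissible p"
  defines "q \<equiv> response U"
  shows "integral {a..b} (\<lambda>t. (p t - q t)\<^sup>2) / 2
    \<le> integral {a..b} (\<lambda>t. Phi (p t) - Phi (q t) - g t (U t) * (prim b p t - prim b q t))"
proof -
  let ?h = "\<lambda>t. g t (U t)" and ?y = "\<lambda>t. - integral {a..t} (\<lambda>r. g r (U r))"
  have pc: "continuous_on {a..b} p" using p by (simp add: admissible_def)
  have qc: "continuous_on {a..b} q" unfolding q_def by (rule continuous_on_response[OF U])
  have dc: "continuous_on {a..b} (\<lambda>t. p t - q t)" by (intro continuous_intros pc qc)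
  note hc = continuous_on_load[OF U] and yc = continuous_on_momentum[OF U]
  have parts: "integral {a..b} (\<lambda>t. ?h t * prim b (\<lambda>t. p t - q t) t)
      = integral {a..b} (\<lambda>t. ?y t * (p t - q t))"
    by (rule integral_by_parts_prim[OF hc dc]) (use ab in simp)
  have "integral {a..b} (\<lambda>t. (p t - q t)\<^sup>2) / 2 = integral {a..b} (\<lambda>t. (p t - q t)\<^sup>2 / 2)"
    by simp
  also have "\<dots> \<le> integral {a..b} (\<lambda>t. Phi (p t) - Phi (q t) - ?y t * (p t - q t))"
  proof (rule integral_le)
    fix t assume "t \<in> {a..b}"
    then have "\<bar>p t\<bar> \<le> 1" using p by (simp add: admissible_def)
    from Phi_uniformly_convex[OF this, of "?y t"]
    show "(p t - q t)\<^sup>2 / 2 \<le> Phi (p t) - Phi (q t) - ?y t * (p t - q t)"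
      by (simp add: q_def response_def)
  qed (intro integrable_continuous_real continuous_on_diff continuous_on_mult continuous_on_divide
        continuous_on_power continuous_on_const continuous_on_Phi yc pc qc; simp)+
  also have "\<dots> = integral {a..b} (\<lambda>t. Phi (p t) - Phi (q t)) - integral {a..b} (\<lambda>t. ?y t * (p t - q t))"
    by (rule integral_diff; intro integrable_continuous_real continuous_intros yc pc qc)
  also have "\<dots> = integral {a..b} (\<lambda>t. Phi (p t) - Phi (q t))
      - integral {a..b} (\<lambda>t. ?h t * prim b (\<lambda>t. p t - q t) t)"
    by (simp only: parts)
  also have "\<dots> = integral {a..b} (\<lambda>t. Phi (p t) - Phi (q t) - ?h t * prim b (\<lambda>t. p t - q t) t)"
    by (rule integral_diff[symmetric];
        intro integrable_continuous_real continuous_intros hc pc qc continuous_on_prim)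
  also have "\<dots> = integral {a..b} (\<lambda>t. Phi (p t) - Phi (q t) - ?h t * (prim b p t - prim b q t))"
    by (rule integral_cong) (simp add: prim_diff[OF pc qc])
  finally show ?thesis .
qed

text \<open>An almost-minimiser \<open>p\<close> of the action whose primitive is close to \<open>U\<close> must be close, in mean
  square, to \<^term>\<open>response U\<close>: moving from \<open>p\<close> towards the response with step \<open>s\<close> lowers the action
  at first order by the convexity gap, up to the oscillation \<open>\<omega>\<close> of \<open>g\<close>.\<close>

lemma near_minimiser_close_to_response:
  assumes U: "continuous_on {a..b} U" and p: "admissible p"
    and m: "\<And>p'. admissible p' \<Longrightarrow> m \<le> action p'" and near: "action p \<le> m + \<delta>"
    and s: "0 < s" "s \<le> 1"
    and close: "\<And>t. t \<in> {a..b} \<Longrightarrow> \<bar>prim b p t - U t\<bar> \<le> \<eta>"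
    and osc: "\<And>t \<xi>. t \<in> {a..b} \<Longrightarrow> \<bar>\<xi> - U t\<bar> \<le> \<eta> + 2 * s * (b - a) \<Longrightarrow> \<bar>g t \<xi> - g t (U t)\<bar> \<le> \<omega>"
  shows "integral {a..b} (\<lambda>t. (p t - response U t)\<^sup>2) / 2 \<le> \<delta> / s + 2 * \<omega> * (b - a)\<^sup>2"
proof -
  let ?q = "response U"
  let ?ps = "\<lambda>t. (1 - s) * p t + s * ?q t"
  let ?u = "prim b p" and ?w = "prim b ?q"
  have pc: "continuous_on {a..b} p" and p1: "\<And>t. t \<in> {a..b} \<Longrightarrow> \<bar>p t\<bar> \<le> 1"
    using p by (auto simp: admissible_def)
  note qc = continuous_on_response[OF U]
  have q1: "\<bar>?q t\<bar> < 1" for t by (simp add: response_def abs_psi_less_1)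
  have ps: "admissible ?ps"
    unfolding admissible_def
  proof (intro conjI ballI continuous_intros pc qc)
    fix t assume t: "t \<in> {a..b}"
    have "\<bar>?ps t\<bar> \<le> (1 - s) * \<bar>p t\<bar> + s * \<bar>?q t\<bar>"
      using s abs_triangle_ineq[of "(1 - s) * p t" "s * ?q t"] by (simp add: abs_mult)
    also have "\<dots> \<le> (1 - s) * 1 + s * 1"
      using p1[OF t] q1[of t] s by (intro add_mono mult_left_mono) auto
    finally show "\<bar>?ps t\<bar> \<le> 1" by simp
  qed
  define gap where "gap = (\<lambda>t. Phi (p t) - Phi (?q t) - g t (U t) * (?u t - ?w t))"
  have gapc: "continuous_on {a..b} gap"
    unfolding gap_def
    by (intro continuous_intros pc qc continuous_on_load U continuous_on_prim) auto
  define P where "P = (\<lambda>t. Phi (p t) - G t (?u t))"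
  have Pc: "continuous_on {a..b} P"
    unfolding P_def by (rule continuous_on_action_integrand[OF p])
  define k where "k = 2 * s * (b - a) * \<omega>"
  have pointwise: "Phi (?ps t) - G t (prim b ?ps t) \<le> P t - s * gap t + k"
    if t: "t \<in> {a..b}" for t
  proof -
    define v where "v = ?w t - ?u t"
    have u1: "\<bar>?u t\<bar> \<le> b - a" and w1: "\<bar>?w t\<bar> \<le> b - a"
      using p1 q1 by (auto intro: abs_prim_le[OF pc t] abs_prim_le[OF qc t] less_imp_le[OF q1])
    have "\<bar>v\<bar> \<le> \<bar>?w t\<bar> + \<bar>?u t\<bar>"
      unfolding v_def by (rule abs_triangle_ineq4)
    also have "\<dots> \<le> 2 * (b - a)"
      using add_mono[OF w1 u1] by simp
    finally have v: "\<bar>v\<bar> \<le> 2 * (b - a)" .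
    have us: "prim b ?ps t = ?u t + s * v"
      unfolding v_def by (rule prim_combination[OF pc qc t])
    obtain \<xi> where \<xi>: "G t (?u t + s * v) - G t (?u t) = (s * v) * g t \<xi>" "\<bar>\<xi> - ?u t\<bar> \<le> \<bar>s * v\<bar>"
      using G_mean_value[OF t, of "?u t + s * v" "?u t"] by auto
    have sv: "\<bar>s * v\<bar> \<le> 2 * s * (b - a)"
      using mult_left_mono[OF v, of s] s by (simp add: abs_mult algebra_simps)
    have "\<bar>g t \<xi> - g t (U t)\<bar> \<le> \<omega>"
      by (rule osc[OF t]) (use close[OF t] \<xi>(2) sv in linarith)
    then have "\<bar>(s * v) * (g t \<xi> - g t (U t))\<bar> \<le> 2 * s * (b - a) * \<omega>"
      unfolding abs_mult[of "s * v"] using sv by (intro mult_mono) auto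
    then have "(s * v) * g t \<xi> \<ge> s * v * g t (U t) - k"
      by (simp add: k_def algebra_simps abs_le_iff)
    moreover have "Phi (?ps t) \<le> (1 - s) * Phi (p t) + s * Phi (?q t)"
      by (rule Phi_convex_combination[OF p1[OF t] q1 s])
    ultimately show ?thesis
      using \<xi>(1) unfolding us P_def gap_def v_def by (simp add: algebra_simps)
  qed
  have "m \<le> action ?ps" by (rule m[OF ps])
  also have "\<dots> \<le> integral {a..b} (\<lambda>t. P t - s * gap t + k)"
    unfolding action_def
    by (intro integral_le integrable_continuous_real continuous_on_action_integrand[OF ps] pointwise)
       (intro continuous_intros Pc gapc)
  also have "\<dots> = integral {a..b} P - s * integral {a..b} gap + k * (b - a)"
  proof -
    have "((\<lambda>t. P t - s * gap t + k) has_integral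
        (integral {a..b} P - s * integral {a..b} gap + k * (b - a))) {a..b}"
      using has_integral_const_real[of k a b] ab
      by (intro has_integral_add has_integral_diff has_integral_mult_right)
         (auto simp: mult.commute intro!: integrable_integral integrable_continuous_real Pc gapc)
    then show ?thesis by (rule integral_unique)
  qed
  also have "integral {a..b} P \<le> m + \<delta>"
    using near by (simp add: action_def P_def)
  finally have "s * integral {a..b} gap \<le> \<delta> + k * (b - a)" by simp
  then have "integral {a..b} gap \<le> (\<delta> + k * (b - a)) / s"
    using s(1) by (simp add: pos_le_divide_eq mult.commute)
  moreover have "integral {a..b} (\<lambda>t. (p t - ?q t)\<^sup>2) / 2 \<le> integral {a..b} gap"
    unfolding gap_def by (rule load_energy_gap[OF U p])
  ultimately have "integral {a..b} (\<lambda>t. (p t - ?q t)\<^sup>2) / 2 \<le> (\<delta> + k * (b - a)) / s"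
    by (rule order_trans[rotated])
  also have "\<dots> = \<delta> / s + 2 * \<omega> * (b - a)\<^sup>2"
    using s by (simp add: k_def power2_eq_square field_simps)
  finally show ?thesis .
qed

lemma G_bound:
  assumes "\<And>s. \<bar>s\<bar> \<le> R \<Longrightarrow> \<bar>g t s\<bar> \<le> M" "t \<in> {a..b}" "\<bar>s\<bar> \<le> R"
  shows "\<bar>G t s\<bar> \<le> M * \<bar>s\<bar>"
proof -
  obtain \<xi> where \<xi>: "G t s - G t 0 = (s - 0) * g t \<xi>" "\<bar>\<xi> - 0\<bar> \<le> \<bar>s - 0\<bar>"
    using G_mean_value[OF assms(2)] by blast
  then have "\<bar>g t \<xi>\<bar> \<le> M" using assms(1)[of \<xi>] assms(3) by simp
  then have "\<bar>s\<bar> * \<bar>g t \<xi>\<bar> \<le> \<bar>s\<bar> * M" by (rule mult_left_mono) simp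
  then show ?thesis using \<xi>(1) by (simp add: abs_mult mult.commute)
qed

text \<open>A fixed point of \<open>u \<mapsto> prim b (response u)\<close> is exactly a solution of the integrated boundary
  value problem.\<close>

theorem exists_nontrivial_critical_point:
  assumes p0: "admissible p0" "action p0 < 0"
  obtains u where "continuous_on {a..b} u" "\<And>t. t \<in> {a..b} \<Longrightarrow> u t = prim b (response u) t"
    "\<exists>t\<in>{a..b}. u t \<noteq> 0"
proof -
  define L where "L = b - a"
  have L: "L > 0" using ab by (simp add: L_def)
  obtain M where M: "M > 0" "\<And>t s. t \<in> {a..b} \<Longrightarrow> \<bar>s\<bar> \<le> L \<Longrightarrow> \<bar>g t s\<bar> \<le> M"
    using g_bounded by blast
  have prim_le: "\<bar>prim b p t\<bar> \<le> L" if "admissible p" "t \<in> {a..b}" for p t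
    unfolding L_def using that by (intro abs_prim_le) (auto simp: admissible_def)
  have action_ge: "- (M * \<eta> * L) \<le> action p"
    if p: "admissible p" and \<eta>: "\<And>t. t \<in> {a..b} \<Longrightarrow> \<bar>prim b p t\<bar> \<le> \<eta>" for p \<eta>
  proof -
    have "integral {a..b} (\<lambda>t. - (M * \<eta>)) \<le> action p"
      unfolding action_def
    proof (intro integral_le integrable_continuous_real continuous_on_action_integrand[OF p])
      fix t assume t: "t \<in> {a..b}"
      have "\<bar>G t (prim b p t)\<bar> \<le> M * \<bar>prim b p t\<bar>"
        by (rule G_bound[OF M(2)[OF t] t prim_le[OF p t]])
      also have "\<dots> \<le> M * \<eta>"
        using M(1) \<eta>[OF t] by (simp add: mult_left_mono)
      finally show "- (M * \<eta>) \<le> Phi (p t) - G t (prim b p t)"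
        using Phi_nonneg[of "p t"] p t by (auto simp: admissible_def)
    qed simp
    then show ?thesis using ab by (simp add: L_def algebra_simps)
  qed
  \<comment> \<open>a minimising sequence\<close>
  define A where "A = action ` Collect admissible"
  define m where "m = Inf A"
  have bdd: "bdd_below A"
    unfolding A_def by (rule bdd_belowI[of _ "- (M * L * L)"]) (use action_ge prim_le in blast)
  have m: "m \<le> action p" if "admissible p" for p
    unfolding m_def by (rule cInf_lower[OF _ bdd]) (use that in \<open>auto simp: A_def\<close>)
  have "\<exists>p. admissible p \<and> action p \<le> m + 1 / real (Suc n)" for n
  proof -
    have "A \<noteq> {}" using p0 by (auto simp: A_def)
    moreover have "Inf A < m + 1 / real (Suc n)" by (simp add: m_def)
    ultimately show ?thesis
      using cInf_less_iff[OF _ bdd] by (force simp: A_def intro: less_imp_le)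
  qed
  then obtain P where P: "\<And>n. admissible (P n)" "\<And>n. action (P n) \<le> m + 1 / real (Suc n)"
    by metis
  obtain U k where Uc: "continuous_on {a..b} U" and k: "strict_mono (k :: nat \<Rightarrow> nat)"
    and conv: "\<And>e. 0 < e \<Longrightarrow> \<exists>N. \<forall>n x. n \<ge> N \<and> x \<in> {a..b} \<longrightarrow> norm (prim b (P (k n)) x - U x) < e"
  proof (rule Arzela_Ascoli[of "{a..b}" "\<lambda>n. prim b (P n)" L])
    show "norm (prim b (P n) x) \<le> L" if "x \<in> {a..b}" for n x
      using prim_le[OF P(1) that] by simp
    show "\<exists>d>0. \<forall>n y. y \<in> {a..b} \<and> norm (x - y) < d \<longrightarrow> norm (prim b (P n) x - prim b (P n) y) < e"
      if "x \<in> {a..b}" "0 < e" for x e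
    proof (intro exI[of _ e] conjI allI impI)
      fix n y assume y: "y \<in> {a..b} \<and> norm (x - y) < e"
      have "\<bar>prim b (P n) x - prim b (P n) y\<bar> \<le> \<bar>x - y\<bar>"
        using P(1)[of n] that y by (intro prim_lipschitz) (auto simp: admissible_def)
      with y show "norm (prim b (P n) x - prim b (P n) y) < e" by simp
    qed (use that in simp)
  qed (auto intro: that)
  have good: "\<exists>p. admissible p \<and> action p \<le> m + \<delta> \<and> (\<forall>t\<in>{a..b}. \<bar>prim b p t - U t\<bar> \<le> \<eta>)"
    if \<delta>: "\<delta> > 0" and \<eta>: "\<eta> > 0" for \<delta> \<eta>
  proof -
    obtain N where N: "\<And>n x. n \<ge> N \<Longrightarrow> x \<in> {a..b} \<Longrightarrow> norm (prim b (P (k n)) x - U x) < \<eta>"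
      using conv[OF \<eta>] by blast
    obtain N' where N': "inverse (real (Suc N')) < \<delta>" using reals_Archimedean[OF \<delta>] by blast
    define n where "n = max N N'"
    have "N' \<le> k n" using seq_suble[OF k, of n] by (simp add: n_def)
    then have "1 / real (Suc (k n)) \<le> 1 / real (Suc N')" by (intro divide_left_mono) auto
    then have "action (P (k n)) \<le> m + \<delta>" using P(2)[of "k n"] N' by (simp add: inverse_eq_divide)
    then show ?thesis
      using P(1) N[of n] by (intro exI[of _ "P (k n)"]) (auto simp: n_def intro: less_imp_le)
  qed
  obtain R where R: "\<And>t. t \<in> {a..b} \<Longrightarrow> \<bar>U t\<bar> \<le> R"
    using compact_imp_bounded[OF compact_continuous_image[OF Uc compact_Icc]]
    unfolding bounded_iff by (metis imageI real_norm_def)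
  have fixed: "U t = prim b (response U) t" if t: "t \<in> {a..b}" for t
  proof -
    have "\<bar>U t - prim b (response U) t\<bar> \<le> 0 + e" if e: "e > 0" for e
    proof -
      \<comment> \<open>\<open>c\<close> and \<open>\<kappa>\<close> split the error of the mean square estimate into two parts \<open>e / 3\<close>;
        \<open>\<omega>\<close> and \<open>\<delta>\<close> then bound the mean square by \<open>\<kappa> / 2 + \<kappa> / 2\<close>\<close>
      define c where "c = 2 * e / (3 * L)"
      define \<kappa> where "\<kappa> = 2 * c * e / 3"
      define \<omega> where "\<omega> = \<kappa> / (8 * L\<^sup>2)"
      have c: "c > 0" and \<kappa>: "\<kappa> > 0" and \<omega>: "\<omega> > 0"
        using e L by (auto simp: c_def \<kappa>_def \<omega>_def)
      obtain d where d: "d > 0"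
        "\<And>t s s'. t \<in> {a..b} \<Longrightarrow> \<bar>s\<bar> \<le> R \<Longrightarrow> \<bar>s' - s\<bar> < d \<Longrightarrow> \<bar>g t s' - g t s\<bar> < \<omega>"
        using g_uniformly_continuous[OF \<omega>] by blast
      define s where "s = min 1 (d / (8 * L))"
      define \<eta> where "\<eta> = min (d / 4) (e / 3)"
      define \<delta> where "\<delta> = \<kappa> * s / 4"
      have s: "0 < s" "s \<le> 1" and \<eta>: "\<eta> > 0" and \<delta>: "\<delta> > 0"
        using d(1) L e \<kappa> by (auto simp: s_def \<eta>_def \<delta>_def)
      have "s \<le> d / (8 * L)" by (simp add: s_def)
      then have "2 * s * L \<le> d / 4" using L by (simp add: field_simps)
      then have radius: "\<eta> + 2 * s * L < d" using d(1) by (simp add: \<eta>_def min_def)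
      obtain p where p: "admissible p" "action p \<le> m + \<delta>" "\<And>t. t \<in> {a..b} \<Longrightarrow> \<bar>prim b p t - U t\<bar> \<le> \<eta>"
        using good[OF \<delta> \<eta>] by blast
      have pc: "continuous_on {a..b} p" using p(1) by (simp add: admissible_def)
      note qc = continuous_on_response[OF Uc]
      have "integral {a..b} (\<lambda>t. (p t - response U t)\<^sup>2) / 2 \<le> \<delta> / s + 2 * \<omega> * L\<^sup>2"
        unfolding L_def
        by (rule near_minimiser_close_to_response[OF Uc p(1) m p(2) s p(3)])
           (use radius d(2) R in \<open>force simp: L_def intro: less_imp_le\<close>)+
      also have "\<dots> = \<kappa> / 2"
        using s L by (simp add: \<delta>_def \<omega>_def field_simps)
      finally have I: "integral {a..b} (\<lambda>t. (p t - response U t)\<^sup>2) \<le> \<kappa>" by simp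
      have "\<bar>prim b p t - prim b (response U) t\<bar>
          \<le> c * L / 2 + integral {a..b} (\<lambda>t. (p t - response U t)\<^sup>2) / (2 * c)"
        unfolding prim_diff[OF pc qc t] L_def
        by (rule abs_prim_le_L2[OF continuous_on_diff[OF pc qc] t c])
      also have "\<dots> \<le> c * L / 2 + \<kappa> / (2 * c)"
        using I c by (simp add: divide_right_mono)
      also have "\<dots> = 2 * e / 3"
        using L c unfolding \<kappa>_def by (simp add: c_def field_simps)
      finally have "\<bar>prim b p t - prim b (response U) t\<bar> \<le> 2 * e / 3" .
      moreover have "\<bar>U t - prim b p t\<bar> \<le> e / 3"
        using p(3)[OF t] unfolding abs_minus_commute[of "U t"] by (simp add: \<eta>_def)
      ultimately show ?thesis
        using abs_triangle_ineq[of "U t - prim b p t" "prim b p t - prim b (response U) t"] by simp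
    qed
    then have "\<bar>U t - prim b (response U) t\<bar> \<le> 0" by (rule field_le_epsilon)
    then show ?thesis by simp
  qed
  \<comment> \<open>the action of slopes with small primitives is almost nonnegative\<close>
  have "\<exists>t\<in>{a..b}. U t \<noteq> 0"
  proof (rule ccontr)
    assume "\<not> ?thesis"
    then have U0: "U t = 0" if "t \<in> {a..b}" for t using that by blast
    have m0: "m < 0" using m[OF p0(1)] p0(2) by linarith
    have "- m / 4 / (M * L) > 0" using m0 M(1) L by (simp add: divide_neg_pos)
    from good[OF _ this, of "- m / 2"] m0
    obtain p where p: "admissible p" "action p \<le> m / 2"
      "\<And>t. t \<in> {a..b} \<Longrightarrow> \<bar>prim b p t\<bar> \<le> - m / 4 / (M * L)"
      using U0 by auto
    have "- (M * (- m / 4 / (M * L)) * L) \<le> action p" by (rule action_ge[OF p(1,3)])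
    then show False using p(2) m0 M(1) L by simp
  qed
  then show thesis using that[OF Uc fixed] by blast
qed

end

section \<open>From critical points to solutions\<close>

lemma deriv_on_eq:
  assumes "a < b" "t \<in> {a..b}" "(u has_real_derivative d) (at t within {a..b})"
  shows "deriv_on a b u t = d"
  using assms unfolding deriv_on_def has_real_derivative_iff_has_vector_derivative
  by (rule vector_derivative_within_closed_interval)

lemma C1_onI:
  assumes "a < b" "\<And>t. t \<in> {a..b} \<Longrightarrow> (u has_real_derivative u' t) (at t within {a..b})"
    and "continuous_on {a..b} u'"
  shows "C1_on a b u"
  unfolding C1_on_def
proof
  show "u differentiable_on {a..b}"
    unfolding differentiable_on_def
    by (meson assms(2) has_field_derivative_imp_has_derivative differentiableI)
  show "continuous_on {a..b} (deriv_on a b u)"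
    using assms(3) by (rule continuous_on_eq) (simp add: deriv_on_eq[OF assms(1) _ assms(2)])
qed

lemma C1_on_has_derivative:
  assumes "C1_on a b u" "t \<in> {a..b}"
  shows "(u has_real_derivative deriv_on a b u t) (at t within {a..b})"
  using assms unfolding C1_on_def deriv_on_def has_real_derivative_iff_has_vector_derivative
    differentiable_on_def vector_derivative_works[symmetric] by blast

lemma has_real_derivative_transform:
  assumes "(f has_real_derivative d) (at x within S)" "x \<in> S" "\<And>x. x \<in> S \<Longrightarrow> h x = f x"
  shows "(h has_real_derivative d) (at x within S)"
  using assms has_vector_derivative_transform[of x S h f d]
  unfolding has_real_derivative_iff_has_vector_derivative by blast

lemma nondecreasing_of_deriv_within:
  fixes u :: "real \<Rightarrow> real"
  assumes der: "\<And>t. t \<in> {a..b} \<Longrightarrow> (u has_real_derivative u' t) (at t within {a..b})"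
    and cd: "a \<le> c" "c \<le> d" "d \<le> b"
    and nonneg: "\<And>t. c < t \<Longrightarrow> t < d \<Longrightarrow> 0 \<le> u' t"
  shows "u c \<le> u d"
proof (rule DERIV_nonneg_imp_increasing_open[OF cd(2)])
  show "continuous_on {c..d} u"
    using DERIV_continuous_on[OF der] by (rule continuous_on_subset) (use cd in auto)
  show "\<exists>y. DERIV u t :> y \<and> y \<ge> 0" if "c < t" "t < d" for t
    using der[of t] nonneg[OF that] that cd by (auto simp: at_within_Icc_at)
qed

context action_functional begin

context
  fixes u :: "real \<Rightarrow> real"
  assumes u_cont: "continuous_on {a..b} u"
    and u_fixed: "\<And>t. t \<in> {a..b} \<Longrightarrow> u t = prim b (response u) t"
begin

lemma fixed_point_has_derivative:
  assumes "t \<in> {a..b}"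
  shows "(u has_real_derivative response u t) (at t within {a..b})"
  by (rule has_real_derivative_transform[OF
        prim_has_derivative[OF continuous_on_response[OF u_cont] assms] assms]) (rule u_fixed)

lemma fixed_point_is_solution: "is_solution a b g u"
proof -
  let ?y = "\<lambda>t. - integral {a..t} (\<lambda>r. g r (u r))"
  note rc = continuous_on_response[OF u_cont]
  have du: "deriv_on a b u t = response u t" if "t \<in> {a..b}" for t
    by (rule deriv_on_eq[OF ab that fixed_point_has_derivative[OF that]])
  have momentum: "phi (deriv_on a b u t) = ?y t" if "t \<in> {a..b}" for t
    unfolding du[OF that] response_def by (rule phi_psi)
  have dy: "((\<lambda>t. phi (deriv_on a b u t)) has_real_derivative - g t (u t)) (at t within {a..b})"
    if "t \<in> {a..b}" for t
    by (rule has_real_derivative_transform[OF momentum_has_derivative[OF u_cont that] that])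
       (rule momentum)
  have "max_norm a b (deriv_on a b u) < 1"
  proof -
    obtain s where "\<forall>t\<in>{a..b}. \<bar>response u t\<bar> \<le> \<bar>response u s\<bar>"
      using continuous_attains_sup[OF compact_Icc _ continuous_on_rabs[OF rc]] ab by auto
    then have "max_norm a b (deriv_on a b u) \<le> \<bar>response u s\<bar>"
      unfolding max_norm_def using ab by (intro cSUP_least) (auto simp: du)
    then show ?thesis using abs_psi_less_1 unfolding response_def by (rule le_less_trans)
  qed
  moreover have "C1_on a b u"
    by (rule C1_onI[OF ab fixed_point_has_derivative rc])
  moreover have "C1_on a b (\<lambda>t. phi (deriv_on a b u t))"
    by (rule C1_onI[OF ab dy]) (auto intro!: continuous_on_minus continuous_on_load u_cont)
  moreover have "- deriv_on a b (\<lambda>s. phi (deriv_on a b u s)) t = g t (u t)" if "t \<in> {a<..<b}" for t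
    using deriv_on_eq[OF ab _ dy, of t] that by simp
  moreover have "deriv_on a b u a = 0"
    using du[of a] ab by (simp add: response_def)
  moreover have "u b = 0"
    using u_fixed[of b] ab by simp
  ultimately show ?thesis by (simp add: is_solution_def)
qed

text \<open>At a minimum point other than \<open>b\<close> the momentum \<open>phi(u')\<close> vanishes: at \<open>a\<close> by the boundary
  condition, inside the interval because \<open>u'\<close> vanishes there.\<close>

lemma momentum_zero_at_minimum:
  assumes s: "a \<le> s" "s < b" and min: "\<And>t. t \<in> {a..b} \<Longrightarrow> u s \<le> u t"
  shows "integral {a..s} (\<lambda>r. g r (u r)) = 0"
proof (cases "s = a")
  case False
  then have s': "a < s" using s by simp
  have "DERIV u s :> response u s"
    using fixed_point_has_derivative[of s] s s' by (simp add: at_within_Icc_at)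
  moreover have "0 < min (s - a) (b - s)" using s s' by simp
  moreover have "\<forall>t. \<bar>s - t\<bar> < Orderings.min (s - a) (b - s) \<longrightarrow> u s \<le> u t"
    by (intro allI impI min) (auto simp: abs_less_iff)
  ultimately have "response u s = 0" by (rule DERIV_local_min)
  then have "phi (psi (- integral {a..s} (\<lambda>r. g r (u r)))) = phi 0" by (simp add: response_def)
  then show ?thesis by (simp add: phi_psi) (simp add: phi_def)
qed simp

text \<open>Starting from a negative minimum, the load is zero as long as \<open>u\<close> stays negative, so
  \<open>u\<close> keeps its slope \<open>0\<close> and never reaches its boundary value \<open>0\<close>.\<close>

lemma fixed_point_nonneg:
  assumes g0: "\<And>t s. t \<in> {a..b} \<Longrightarrow> s \<le> 0 \<Longrightarrow> g t s = 0" and t: "t \<in> {a..b}"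
  shows "0 \<le> u t"
proof -
  obtain s where s: "s \<in> {a..b}" and min: "\<And>t. t \<in> {a..b} \<Longrightarrow> u s \<le> u t"
    using continuous_attains_inf[of "{a..b}" u] u_cont ab by auto
  have ub: "u b = 0" using u_fixed[of b] ab by simp
  have "u s \<ge> 0"
  proof (rule ccontr)
    assume neg: "\<not> u s \<ge> 0"
    then have sb: "s < b" using s ub by (cases "s = b") auto
    define Z where "Z = {s..b} \<inter> u -` {0..}"
    have "closed Z"
      unfolding Z_def using s
      by (intro continuous_closed_preimage continuous_on_subset[OF u_cont]) auto
    moreover have "b \<in> Z" and bdd: "bdd_below Z"
      using sb ub by (auto simp: Z_def)
    ultimately have "Inf Z \<in> Z" by (intro closed_contains_Inf) auto
    then obtain d where d: "d \<in> Z" and before: "\<And>t. t \<in> Z \<Longrightarrow> d \<le> t"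
      using cInf_lower[OF _ bdd] by blast
    have sd: "s < d" using d neg by (cases "s = d") (auto simp: Z_def)
    have neg': "u t < 0" if "s \<le> t" "t < d" for t
      using before[of t] that d by (force simp: Z_def)
    have "u d = u s"
    proof (rule DERIV_isconst_end[OF sd])
      show "continuous_on {s..d} u"
        using s d by (intro continuous_on_subset[OF u_cont]) (auto simp: Z_def)
      fix t assume t: "s < t" "t < d"
      have tI: "a < t" "t < b" using t s d by (auto simp: Z_def)
      have "integral {a..s} (\<lambda>r. g r (u r)) + integral {s..t} (\<lambda>r. g r (u r))
          = integral {a..t} (\<lambda>r. g r (u r))"
        using t s tI by (intro Henstock_Kurzweil_Integration.integral_combine
            integrable_continuous_real
            continuous_on_subset[OF continuous_on_load[OF u_cont]]) auto
      moreover have "integral {s..t} (\<lambda>r. g r (u r)) = integral {s..t} (\<lambda>r. 0)"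
        using neg' t tI s by (intro integral_cong g0) (auto intro: less_imp_le)
      moreover have "integral {a..s} (\<lambda>r. g r (u r)) = 0"
        using s sb min by (intro momentum_zero_at_minimum) auto
      ultimately have "response u t = 0" by (simp add: response_def)
      then show "DERIV u t :> 0"
        using fixed_point_has_derivative[of t] tI by (simp add: at_within_Icc_at)
    qed
    then show False using d neg by (simp add: Z_def)
  qed
  then show ?thesis using min[OF t] by simp
qed

text \<open>Strong maximum principle. If \<open>u\<close> vanishes at \<open>s < b\<close>, then so does its momentum, and the
  linear lower bound on \<open>g\<close> gives \<open>phi(u') \<le> Y\<close> to the right of \<open>s\<close> and \<open>phi(u') \<ge> Y\<close> to the left,
  where \<open>Y\<close> is \<open>B\<close> times the integral of \<open>u\<close> from \<open>s\<close>. Gronwall's argument for \<open>u + \<bar>Y\<bar>\<close>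
  then forces \<open>u = 0\<close> on both sides.\<close>

lemma fixed_point_zero:
  assumes nonneg: "\<And>t. t \<in> {a..b} \<Longrightarrow> 0 \<le> u t"
    and lower: "\<And>t s. t \<in> {a..b} \<Longrightarrow> 0 \<le> s \<Longrightarrow> - B * s \<le> g t s" and B: "B \<ge> 0"
    and s: "a \<le> s" "s < b" "u s = 0" and t: "t \<in> {a..b}"
  shows "u t = 0"
proof -
  define y where "y = (\<lambda>t. - integral {a..t} (\<lambda>r. g r (u r)))"
  define Y where "Y = (\<lambda>t. B * (integral {a..t} u - integral {a..s} u))"
  define \<kappa> where "\<kappa> = B + 1"
  have \<kappa>: "B \<le> \<kappa>" "1 \<le> \<kappa>" using B by (auto simp: \<kappa>_def)
  have y': "(y has_real_derivative - g t (u t)) (at t within {a..b})" if "t \<in> {a..b}" for t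
    unfolding y_def by (rule momentum_has_derivative[OF u_cont that])
  have Y': "(Y has_real_derivative B * u t) (at t within {a..b})" if "t \<in> {a..b}" for t
    unfolding Y_def using integral_has_real_derivative[OF u_cont that]
    by (auto intro!: derivative_eq_intros)
  have u': "(u has_real_derivative psi (y t)) (at t within {a..b})" if "t \<in> {a..b}" for t
    using fixed_point_has_derivative[OF that] by (simp add: response_def y_def)
  have Ys: "Y s = 0" by (simp add: Y_def)
  have ys: "y s = 0"
    using momentum_zero_at_minimum[OF s(1,2)] nonneg s(3) by (simp add: y_def)
  have Ymono: "Y c \<le> Y d" if "a \<le> c" "c \<le> d" "d \<le> b" for c d
    by (rule nondecreasing_of_deriv_within[OF Y' that]) (use that nonneg B in auto)
  have Yymono: "Y c - y c \<le> Y d - y d" if "a \<le> c" "c \<le> d" "d \<le> b" for c d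
  proof (rule nondecreasing_of_deriv_within[of a b "\<lambda>t. Y t - y t", OF _ that])
    show "((\<lambda>t. Y t - y t) has_real_derivative B * u t - - g t (u t)) (at t within {a..b})"
      if "t \<in> {a..b}" for t
      by (rule DERIV_diff[OF Y'[OF that] y'[OF that]])
    show "0 \<le> B * u t - - g t (u t)" if "c < t" "t < d" for t
      using lower[of t "u t"] nonneg[of t] that \<open>a \<le> c\<close> \<open>d \<le> b\<close> by simp
  qed
  have "u t \<le> 0"
  proof (cases "s \<le> t")
    case True
    define E where "E = (\<lambda>r. - (u r + Y r) * exp (- \<kappa> * r))"
    have "E s \<le> E t"
    proof (rule nondecreasing_of_deriv_within[where u = E and c = s and d = t])
      show "(E has_real_derivative (\<kappa> * (u r + Y r) - (psi (y r) + B * u r)) * exp (- \<kappa> * r))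
          (at r within {a..b})" if "r \<in> {a..b}" for r
        unfolding E_def
        by (auto intro!: derivative_eq_intros u'[OF that] Y'[OF that] simp: algebra_simps)
      show "0 \<le> (\<kappa> * (u r + Y r) - (psi (y r) + B * u r)) * exp (- \<kappa> * r)" if r: "s < r" "r < t" for r
      proof -
        have rI: "r \<in> {a..b}" using r s t by auto
        have "0 \<le> Y r" "y r \<le> Y r"
          using Ymono[of s r] Yymono[of s r] Ys ys rI r s by auto
        moreover from this have "psi (y r) \<le> Y r" by (intro psi_le_of_le)
        moreover have "1 * Y r \<le> \<kappa> * Y r"
          using \<kappa> \<open>0 \<le> Y r\<close> by (intro mult_right_mono)
        moreover have "B * u r \<le> \<kappa> * u r"
          using \<kappa> nonneg[OF rI] by (intro mult_right_mono)
        ultimately show ?thesis by (simp add: distrib_left)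
      qed
    qed (use s t True in auto)
    then have "0 \<le> - (u t + Y t) * exp (- \<kappa> * t)" by (simp add: E_def s Ys)
    then have "u t + Y t \<le> 0" by (simp add: zero_le_mult_iff)
    then show ?thesis using Ymono[of s t] Ys s t True by auto
  next
    case False
    define E where "E = (\<lambda>r. (u r - Y r) * exp (\<kappa> * r))"
    have "E t \<le> E s"
    proof (rule nondecreasing_of_deriv_within[where u = E and c = t and d = s])
      show "(E has_real_derivative (\<kappa> * (u r - Y r) + (psi (y r) - B * u r)) * exp (\<kappa> * r))
          (at r within {a..b})" if "r \<in> {a..b}" for r
        unfolding E_def
        by (auto intro!: derivative_eq_intros u'[OF that] Y'[OF that] simp: algebra_simps)
      show "0 \<le> (\<kappa> * (u r - Y r) + (psi (y r) - B * u r)) * exp (\<kappa> * r)" if r: "t < r" "r < s" for r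
      proof -
        have rI: "r \<in> {a..b}" using r s t by auto
        have "Y r \<le> 0" "Y r \<le> y r"
          using Ymono[of r s] Yymono[of r s] Ys ys rI r s by auto
        moreover from this have "psi (- y r) \<le> - Y r" by (intro psi_le_of_le) auto
        moreover have "1 * (- Y r) \<le> \<kappa> * (- Y r)"
          using \<kappa> \<open>Y r \<le> 0\<close> by (intro mult_right_mono) auto
        moreover have "B * u r \<le> \<kappa> * u r"
          using \<kappa> nonneg[OF rI] by (intro mult_right_mono)
        ultimately show ?thesis by (simp add: right_diff_distrib psi_minus)
      qed
    qed (use s t False in auto)
    then have "(u t - Y t) * exp (\<kappa> * t) \<le> 0" by (simp add: E_def s Ys)
    then have "u t - Y t \<le> 0" by (simp add: mult_le_0_iff)
    then show ?thesis using Ymono[of t s] Ys s t False by auto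
  qed
  then show ?thesis using nonneg[OF t] by simp
qed

end

end

section \<open>Test functions of negative energy\<close>

context action_functional begin

lemma G_lower_bound:
  assumes t: "t \<in> {a..b}" and s: "0 \<le> s" "s < s0"
    and lower: "\<And>r. 0 < r \<Longrightarrow> r < s0 \<Longrightarrow> k * r \<le> g t r"
  shows "k * s\<^sup>2 / 2 \<le> G t s"
proof -
  have D: "((\<lambda>r. G t r - k * r\<^sup>2 / 2) has_real_derivative g t r - k * r) (at r)" for r
    by (auto intro!: derivative_eq_intros G_has_derivative[OF t])
  have "G t 0 - k * 0\<^sup>2 / 2 \<le> G t s - k * s\<^sup>2 / 2"
  proof (rule DERIV_nonneg_imp_increasing_open[OF s(1)])
    show "\<exists>y. ((\<lambda>r. G t r - k * r\<^sup>2 / 2) has_real_derivative y) (at r) \<and> 0 \<le> y"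
      if "0 < r" "r < s" for r
      using D[of r] lower[of r] that s(2) by (intro exI[of _ "g t r - k * r"]) simp
    show "continuous_on {0..s} (\<lambda>r. G t r - k * r\<^sup>2 / 2)"
      by (rule DERIV_continuous_on, rule has_field_derivative_at_within, rule D)
  qed
  then show ?thesis by simp
qed

text \<open>For small \<open>\<epsilon>\<close> the action of \<open>\<epsilon> v'\<close> is at most \<open>\<epsilon>\<^sup>2 / 2\<close> times the quadratic energy of \<open>v\<close>, up
  to terms of higher order, where \<open>c\<close> bounds \<open>g(t, s) / s\<close> from below as \<open>s\<close> tends to \<open>0\<close>.\<close>

lemma exists_negative_action:
  assumes c: "continuous_on {a..b} c"
    and lower: "\<And>\<kappa>. \<kappa> > 0 \<Longrightarrow> \<forall>\<^sub>F s in at_right 0. \<forall>t\<in>{a..b}. (c t - \<kappa>) * s \<le> g t s"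
    and v': "\<And>t. t \<in> {a..b} \<Longrightarrow> (v has_real_derivative v' t) (at t within {a..b})"
    and v'c: "continuous_on {a..b} v'" and vb: "v b = 0" and v0: "\<And>t. t \<in> {a..b} \<Longrightarrow> 0 \<le> v t"
    and energy: "integral {a..b} (\<lambda>t. (v' t)\<^sup>2 - c t * (v t)\<^sup>2) < 0"
  shows "\<exists>p. admissible p \<and> action p < 0"
proof -
  define N where "N = integral {a..b} (\<lambda>t. (v' t)\<^sup>2 - c t * (v t)\<^sup>2)"
  have N: "N < 0" using energy by (simp add: N_def)
  have vc: "continuous_on {a..b} v" by (rule DERIV_continuous_on[OF v'])
  have "bounded (v ` {a..b} \<union> v' ` {a..b})"
    by (intro bounded_Un[THEN iffD2] conjI compact_imp_bounded compact_continuous_image vc v'c) auto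
  then obtain V where V: "V > 0" "\<And>t. t \<in> {a..b} \<Longrightarrow> \<bar>v t\<bar> \<le> V" "\<And>t. t \<in> {a..b} \<Longrightarrow> \<bar>v' t\<bar> \<le> V"
    unfolding bounded_pos by auto
  define \<kappa> where "\<kappa> = - N / 4 / (V\<^sup>2 * (b - a))"
  have \<kappa>: "\<kappa> > 0" using N V(1) ab by (auto simp: \<kappa>_def intro!: divide_neg_pos)
  obtain s0 where s0: "s0 > 0"
    "\<And>s t. 0 < s \<Longrightarrow> s < s0 \<Longrightarrow> t \<in> {a..b} \<Longrightarrow> (c t - \<kappa>) * s \<le> g t s"
    using lower[OF \<kappa>] unfolding eventually_at_right_field by blast
  have "((\<lambda>\<epsilon>. \<epsilon> * V) \<longlongrightarrow> 0) (at_right 0)" "((\<lambda>\<epsilon>. \<epsilon>\<^sup>2 * (V ^ 4 * (b - a))) \<longlongrightarrow> 0) (at_right 0)"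
    by (auto intro!: tendsto_eq_intros)
  then have "\<forall>\<^sub>F \<epsilon> in at_right 0. \<epsilon> * V < min 1 s0 \<and> \<epsilon>\<^sup>2 * (V ^ 4 * (b - a)) < - N / 2 \<and> 0 < \<epsilon>"
    using s0(1) N by (intro eventually_conj order_tendstoD(2) eventually_at_right_less) auto
  then obtain \<epsilon> where \<epsilon>: "\<epsilon> * V < 1" "\<epsilon> * V < s0" "\<epsilon>\<^sup>2 * (V ^ 4 * (b - a)) < - N / 2" "0 < \<epsilon>"
    using eventually_happens'[OF trivial_limit_at_right_real] by fastforce
  define p where "p = (\<lambda>t. \<epsilon> * v' t)"
  have small: "\<bar>\<epsilon> * x\<bar> \<le> \<epsilon> * V" if "\<bar>x\<bar> \<le> V" for x
    using that \<epsilon>(4) by (simp add: abs_mult)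
  have p: "admissible p"
    unfolding admissible_def p_def using small[OF V(3)] \<epsilon>(1)
    by (intro conjI ballI continuous_intros v'c) (meson less_imp_le order_trans)
  have prim_p: "prim b p t = \<epsilon> * v t" if "t \<in> {a..b}" for t
    unfolding p_def using vb that
    by (intro prim_eq_of_derivative[of a b "\<lambda>t. \<epsilon> * v t"] DERIV_cmult v') auto
  define W where "W = \<epsilon>\<^sup>2 * V ^ 4 + \<kappa> * V\<^sup>2"
  have "action p \<le> integral {a..b} (\<lambda>t. \<epsilon>\<^sup>2 / 2 * ((v' t)\<^sup>2 - c t * (v t)\<^sup>2 + W))"
    unfolding action_def
  proof (intro integral_le integrable_continuous_real continuous_on_action_integrand[OF p])
    show "continuous_on {a..b} (\<lambda>t. \<epsilon>\<^sup>2 / 2 * ((v' t)\<^sup>2 - c t * (v t)\<^sup>2 + W))"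
      by (intro continuous_intros v'c vc c)
    fix t assume t: "t \<in> {a..b}"
    have "\<bar>p t\<bar> \<le> 1" using p t by (simp add: admissible_def)
    then have "Phi (p t) \<le> (p t)\<^sup>2 / 2 + p t ^ 4 / 2" by (rule Phi_le_quartic)
    also have "\<dots> = \<epsilon>\<^sup>2 / 2 * ((v' t)\<^sup>2 + \<epsilon>\<^sup>2 * v' t ^ 4)"
      by (simp add: p_def power2_eq_square power4_eq_xxxx algebra_simps)
    also have "\<dots> \<le> \<epsilon>\<^sup>2 / 2 * ((v' t)\<^sup>2 + \<epsilon>\<^sup>2 * V ^ 4)"
      using power_mono[OF V(3)[OF t], of 4] by (intro mult_left_mono add_left_mono) (auto simp: power_even_abs)
    finally have 1: "Phi (p t) \<le> \<epsilon>\<^sup>2 / 2 * ((v' t)\<^sup>2 + \<epsilon>\<^sup>2 * V ^ 4)" .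
    have "\<epsilon> * v t < s0" using small[OF V(2)[OF t]] \<epsilon>(2) by linarith
    then have "(c t - \<kappa>) * (\<epsilon> * v t)\<^sup>2 / 2 \<le> G t (\<epsilon> * v t)"
      using v0[OF t] \<epsilon>(4) s0(2) t by (intro G_lower_bound[of t _ s0]) auto
    moreover have "\<kappa> * (v t)\<^sup>2 \<le> \<kappa> * V\<^sup>2"
      using V(2)[OF t] v0[OF t] \<kappa> by (intro mult_left_mono power_mono) auto
    then have "\<epsilon>\<^sup>2 / 2 * (\<kappa> * (v t)\<^sup>2) \<le> \<epsilon>\<^sup>2 / 2 * (\<kappa> * V\<^sup>2)"
      by (rule mult_left_mono) simp
    ultimately have 2: "\<epsilon>\<^sup>2 / 2 * (c t * (v t)\<^sup>2 - \<kappa> * V\<^sup>2) \<le> G t (\<epsilon> * v t)"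
      by (simp add: power_mult_distrib algebra_simps)
    show "Phi (p t) - G t (prim b p t) \<le> \<epsilon>\<^sup>2 / 2 * ((v' t)\<^sup>2 - c t * (v t)\<^sup>2 + W)"
      using 1 2 unfolding prim_p[OF t] W_def by (simp add: algebra_simps)
  qed
  also have "\<dots> = \<epsilon>\<^sup>2 / 2 * (N + W * (b - a))"
  proof -
    have "((\<lambda>t. \<epsilon>\<^sup>2 / 2 * ((v' t)\<^sup>2 - c t * (v t)\<^sup>2 + W)) has_integral \<epsilon>\<^sup>2 / 2 * (N + W * (b - a))) {a..b}"
      using has_integral_const_real[of W a b] ab unfolding N_def
      by (intro has_integral_mult_right has_integral_add integrable_integral
            integrable_continuous_real continuous_intros v'c vc c) (simp add: mult.commute)
    then show ?thesis by (rule integral_unique)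
  qed
  also have "\<dots> < 0"
  proof -
    have "V\<^sup>2 * (b - a) \<noteq> 0" using V(1) ab by simp
    then have "\<kappa> * V\<^sup>2 * (b - a) = - N / 4" unfolding \<kappa>_def mult.assoc by simp
    then have "W * (b - a) < - N / 2 - N / 4"
      using \<epsilon>(3) by (simp add: W_def algebra_simps)
    then have "N + W * (b - a) < 0" using N by simp
    then show ?thesis using \<epsilon>(4) by (intro mult_pos_neg) auto
  qed
  finally show ?thesis using p by blast
qed

end

text \<open>An eigenfunction for an eigenvalue below \<open>1\<close> has negative energy for the weight \<open>c - \<beta>\<close>.\<close>

lemma eigenfunction_negative_energy:
  assumes ab: "a < b" and \<beta>: "continuous_on {a..b} \<beta>" "\<And>t. t \<in> {a..b} \<Longrightarrow> 0 \<le> \<beta> t"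
    and c: "continuous_on {a..b} c" "\<And>t. t \<in> {a..b} \<Longrightarrow> 0 \<le> c t"
    and ev: "is_eigenvalue a b \<beta> c l" and l: "l < 1"
  obtains e where "C1_on a b e" "e b = 0"
    "integral {a..b} (\<lambda>t. (deriv_on a b e t)\<^sup>2 - (c t - \<beta> t) * (e t)\<^sup>2) < 0"
proof -
  obtain e where e: "C1_on a b e" and eq: "\<And>t. t \<in> {a<..<b} \<Longrightarrow>
      deriv_on a b e differentiable (at t) \<and> - deriv (deriv_on a b e) t + \<beta> t * e t = l * c t * e t"
    and bc: "deriv_on a b e a = 0" "e b = 0" and nz: "\<exists>t\<in>{a..b}. e t \<noteq> 0"
    using ev unfolding is_eigenvalue_def by blast
  define q where "q = deriv_on a b e"
  have qc: "continuous_on {a..b} q" using e by (simp add: C1_on_def q_def)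
  have e': "(e has_real_derivative q t) (at t within {a..b})" if "t \<in> {a..b}" for t
    unfolding q_def by (rule C1_on_has_derivative[OF e that])
  have ec: "continuous_on {a..b} e" by (rule DERIV_continuous_on[OF e'])
  have q': "DERIV q t :> (\<beta> t - l * c t) * e t" if "t \<in> {a<..<b}" for t
  proof -
    have "deriv q t = (\<beta> t - l * c t) * e t"
      using eq[OF that] by (simp add: q_def algebra_simps)
    moreover have "q field_differentiable (at t)"
      using eq[OF that] unfolding q_def
      by (simp add: field_differentiable_def real_differentiable_def)
    ultimately show ?thesis
      using DERIV_deriv_iff_field_differentiable by metis
  qed
  \<comment> \<open>the differential equation tested with \<open>e\<close>; both boundary conditions enter\<close>
  have weak: "((\<lambda>t. (q t)\<^sup>2 + (\<beta> t - l * c t) * (e t)\<^sup>2) has_integral 0) {a..b}"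
  proof -
    have "((\<lambda>t. (q t)\<^sup>2 + (\<beta> t - l * c t) * (e t)\<^sup>2) has_integral (e b * q b - e a * q a)) {a..b}"
    proof (rule fundamental_theorem_of_calculus_interior)
      show "continuous_on {a..b} (\<lambda>t. e t * q t)" by (intro continuous_intros ec qc)
      fix t assume t: "t \<in> {a<..<b}"
      have "DERIV e t :> q t" using e'[of t] t by (simp add: at_within_Icc_at)
      from DERIV_mult[OF this q'[OF t]]
      show "((\<lambda>t. e t * q t) has_vector_derivative (q t)\<^sup>2 + (\<beta> t - l * c t) * (e t)\<^sup>2) (at t)"
        by (simp add: has_real_derivative_iff_has_vector_derivative[symmetric] power2_eq_square algebra_simps)
    qed (use ab in simp)
    then show ?thesis using bc by (simp add: q_def)
  qed
  have ce: "continuous_on {a..b} (\<lambda>t. c t * (e t)\<^sup>2)" by (intro continuous_intros c ec)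
  define K where "K = integral {a..b} (\<lambda>t. c t * (e t)\<^sup>2)"
  have "((\<lambda>t. ((q t)\<^sup>2 + (\<beta> t - l * c t) * (e t)\<^sup>2) - (1 - l) * (c t * (e t)\<^sup>2)) has_integral
      (0 - (1 - l) * K)) {a..b}"
    unfolding K_def
    by (intro has_integral_diff weak has_integral_mult_right integrable_integral integrable_continuous_real ce)
  moreover have "(\<lambda>t. ((q t)\<^sup>2 + (\<beta> t - l * c t) * (e t)\<^sup>2) - (1 - l) * (c t * (e t)\<^sup>2))
      = (\<lambda>t. (q t)\<^sup>2 - (c t - \<beta> t) * (e t)\<^sup>2)"
    by (rule ext) (simp add: algebra_simps)
  ultimately have energy: "integral {a..b} (\<lambda>t. (q t)\<^sup>2 - (c t - \<beta> t) * (e t)\<^sup>2) = - ((1 - l) * K)"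
    by (simp add: integral_unique)
  have "K \<ge> 0"
    unfolding K_def by (intro integral_nonneg integrable_continuous_real ce) (use c(2) in auto)
  moreover have "K \<noteq> 0"
  proof
    \<comment> \<open>otherwise \<open>c e\<^sup>2 = 0\<close>, so \<open>e\<close> has zero Dirichlet energy and is constant\<close>
    assume "K = 0"
    then have ce0: "c t * (e t)\<^sup>2 = 0" if "t \<in> {a..b}" for t
      using integral_eq_0_iff[OF ce ab] c(2) that by (simp add: K_def)
    have qe: "continuous_on {a..b} (\<lambda>t. (q t)\<^sup>2 + \<beta> t * (e t)\<^sup>2)" by (intro continuous_intros qc ec \<beta>)
    have "integral {a..b} (\<lambda>t. (q t)\<^sup>2 + \<beta> t * (e t)\<^sup>2)
        = integral {a..b} (\<lambda>t. (q t)\<^sup>2 + (\<beta> t - l * c t) * (e t)\<^sup>2)"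
      using ce0 by (intro integral_cong) (auto simp: algebra_simps)
    then have "integral {a..b} (\<lambda>t. (q t)\<^sup>2 + \<beta> t * (e t)\<^sup>2) = 0"
      using weak by (simp add: integral_unique)
    then have sum0: "(q t)\<^sup>2 + \<beta> t * (e t)\<^sup>2 = 0" if "t \<in> {a..b}" for t
      using integral_eq_0_iff[OF qe ab] \<beta>(2) that by simp
    have "q t = 0" if "t \<in> {a..b}" for t
      using sum0[OF that] \<beta>(2)[OF that] by (simp add: add_nonneg_eq_0_iff)
    moreover have "e t = prim b q t" if "t \<in> {a..b}" for t
      by (rule prim_eq_of_derivative[symmetric, OF e' bc(2) that])
    ultimately have "e t = 0" if "t \<in> {a..b}" for t
      using that integral_cong[of "{t..b}" q "\<lambda>_. 0"] by (simp add: prim_def)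
    then show False using nz by blast
  qed
  ultimately have "0 < (1 - l) * K" using l by (intro mult_pos_pos) auto
  then show thesis
    using that[OF e bc(2)] energy by (simp add: q_def)
qed

text \<open>The absolute value of a function has the same energy, but need not be continuously
  differentiable. It is replaced by \<open>sqrt(e\<^sup>2 + \<eta>\<^sup>2) - \<eta>\<close>, whose slope is no larger and which
  tends to \<open>\<bar>e\<bar>\<close> uniformly as \<open>\<eta>\<close> tends to \<open>0\<close>.\<close>

lemma nonneg_negative_energy:
  assumes ab: "a < b" and c: "continuous_on {a..b} c"
    and e: "C1_on a b e" "e b = 0"
    and energy: "integral {a..b} (\<lambda>t. (deriv_on a b e t)\<^sup>2 - c t * (e t)\<^sup>2) < 0"
  obtains v v' where "\<And>t. t \<in> {a..b} \<Longrightarrow> (v has_real_derivative v' t) (at t within {a..b})"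
    "continuous_on {a..b} v'" "v b = 0" "\<And>t. 0 \<le> v t"
    "integral {a..b} (\<lambda>t. (v' t)\<^sup>2 - c t * (v t)\<^sup>2) < 0"
proof -
  define q where "q = deriv_on a b e"
  define N where "N = integral {a..b} (\<lambda>t. (q t)\<^sup>2 - c t * (e t)\<^sup>2)"
  have N: "N < 0" using energy by (simp add: N_def q_def)
  have qc: "continuous_on {a..b} q" using e by (simp add: C1_on_def q_def)
  have e': "(e has_real_derivative q t) (at t within {a..b})" if "t \<in> {a..b}" for t
    unfolding q_def by (rule C1_on_has_derivative[OF e(1) that])
  have ec: "continuous_on {a..b} e" by (rule DERIV_continuous_on[OF e'])
  have "bounded (c ` {a..b} \<union> e ` {a..b})"
    by (intro bounded_Un[THEN iffD2] conjI compact_imp_bounded compact_continuous_image ec c) auto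
  then obtain C where C: "C > 0" "\<And>t. t \<in> {a..b} \<Longrightarrow> \<bar>c t\<bar> \<le> C" "\<And>t. t \<in> {a..b} \<Longrightarrow> \<bar>e t\<bar> \<le> C"
    unfolding bounded_pos by auto
  define \<eta> where "\<eta> = - N / 4 / (C\<^sup>2 * (b - a))"
  have \<eta>: "\<eta> > 0" using N C(1) ab by (auto simp: \<eta>_def intro!: divide_neg_pos)
  define v where "v = (\<lambda>t. sqrt ((e t)\<^sup>2 + \<eta>\<^sup>2) - \<eta>)"
  define v' where "v' = (\<lambda>t. e t * q t / sqrt ((e t)\<^sup>2 + \<eta>\<^sup>2))"
  have pos: "0 < (x::real)\<^sup>2 + \<eta>\<^sup>2" for x using \<eta> by (simp add: add_nonneg_pos)
  have v_der: "(v has_real_derivative v' t) (at t within {a..b})" if "t \<in> {a..b}" for t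
    unfolding v_def v'_def using pos[of "e t"]
    by (auto intro!: derivative_eq_intros e'[OF that] simp: field_simps)
  have v'c: "continuous_on {a..b} v'"
    unfolding v'_def by (intro continuous_intros qc ec) (use pos in \<open>auto simp: less_le\<close>)
  have vc: "continuous_on {a..b} v" by (rule DERIV_continuous_on[OF v_der])
  have v0: "0 \<le> v t" for t
    using real_le_rsqrt[of \<eta> "(e t)\<^sup>2 + \<eta>\<^sup>2"] by (simp add: v_def)
  have v'_le: "(v' t)\<^sup>2 \<le> (q t)\<^sup>2" for t
  proof -
    have "(v' t)\<^sup>2 = (q t)\<^sup>2 * ((e t)\<^sup>2 / ((e t)\<^sup>2 + \<eta>\<^sup>2))"
      using pos[of "e t"] by (simp add: v'_def power_divide power_mult_distrib mult.commute)
    also have "\<dots> \<le> (q t)\<^sup>2 * 1"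
      using pos[of "e t"] by (intro mult_left_mono) (auto simp: divide_le_eq)
    finally show ?thesis by simp
  qed
  have v_near: "\<bar>(e t)\<^sup>2 - (v t)\<^sup>2\<bar> \<le> 2 * \<eta> * \<bar>e t\<bar>" for t
  proof -
    have up: "v t \<le> \<bar>e t\<bar>"
      unfolding v_def using \<eta>
      by (simp add: algebra_simps) (rule real_le_lsqrt; simp add: power2_sum)
    have lo: "\<bar>e t\<bar> - \<eta> \<le> v t"
      unfolding v_def using real_le_rsqrt[of "\<bar>e t\<bar>" "(e t)\<^sup>2 + \<eta>\<^sup>2"] by simp
    have "(e t)\<^sup>2 - (v t)\<^sup>2 = (\<bar>e t\<bar> - v t) * (\<bar>e t\<bar> + v t)"
      by (simp add: power2_eq_square algebra_simps)
    moreover have "(\<bar>e t\<bar> - v t) * (\<bar>e t\<bar> + v t) \<le> \<eta> * (2 * \<bar>e t\<bar>)"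
      using up lo v0[of t] \<eta> by (intro mult_mono) auto
    moreover have "0 \<le> (\<bar>e t\<bar> - v t) * (\<bar>e t\<bar> + v t)"
      using up v0[of t] by (intro mult_nonneg_nonneg) auto
    ultimately show ?thesis by simp
  qed
  have "integral {a..b} (\<lambda>t. (v' t)\<^sup>2 - c t * (v t)\<^sup>2)
      \<le> integral {a..b} (\<lambda>t. (q t)\<^sup>2 - c t * (e t)\<^sup>2 + 2 * \<eta> * C\<^sup>2)"
  proof (intro integral_le integrable_continuous_real continuous_intros v'c vc qc ec c)
    fix t assume t: "t \<in> {a..b}"
    have "c t * ((e t)\<^sup>2 - (v t)\<^sup>2) \<le> \<bar>c t\<bar> * \<bar>(e t)\<^sup>2 - (v t)\<^sup>2\<bar>"
      by (metis abs_ge_self abs_mult)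
    also have "\<dots> \<le> C * (2 * \<eta> * C)"
    proof (rule mult_mono)
      have "2 * \<eta> * \<bar>e t\<bar> \<le> 2 * \<eta> * C"
        using C(3)[OF t] \<eta> by (intro mult_left_mono) auto
      then show "\<bar>(e t)\<^sup>2 - (v t)\<^sup>2\<bar> \<le> 2 * \<eta> * C" using v_near[of t] by (rule order_trans[rotated])
    qed (use C t in auto)
    finally show "(v' t)\<^sup>2 - c t * (v t)\<^sup>2 \<le> (q t)\<^sup>2 - c t * (e t)\<^sup>2 + 2 * \<eta> * C\<^sup>2"
      using v'_le[of t] by (simp add: power2_eq_square algebra_simps)
  qed
  also have "\<dots> = N + 2 * \<eta> * C\<^sup>2 * (b - a)"
  proof -
    have "((\<lambda>t. (q t)\<^sup>2 - c t * (e t)\<^sup>2 + 2 * \<eta> * C\<^sup>2) has_integral (N + 2 * \<eta> * C\<^sup>2 * (b - a))) {a..b}"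
      using has_integral_const_real[of "2 * \<eta> * C\<^sup>2" a b] ab unfolding N_def
      by (intro has_integral_add integrable_integral integrable_continuous_real
            continuous_intros qc ec c) (simp add: mult.commute)
    then show ?thesis by (rule integral_unique)
  qed
  also have "\<dots> = N / 2"
  proof -
    have "C\<^sup>2 * (b - a) \<noteq> 0" using C(1) ab by simp
    then have "\<eta> * (C\<^sup>2 * (b - a)) = - N / 4" unfolding \<eta>_def by simp
    then show ?thesis by (simp add: mult.assoc)
  qed
  finally have "integral {a..b} (\<lambda>t. (v' t)\<^sup>2 - c t * (v t)\<^sup>2) < 0" using N by simp
  moreover have "v b = 0" using e(2) \<eta> by (simp add: v_def)
  ultimately show thesis using that[OF v_der v'c _ v0] by blast
qed

section \<open>Existence of a positive solution\<close>

theorem corollary4p1: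
  fixes a b :: real
    and f :: "real \<Rightarrow> real \<Rightarrow> real"
    and \<beta> :: "real \<Rightarrow> real"
  assumes ab: "a < b"
    and f_cont: "continuous_on ({a..b} \<times> {0..}) (\<lambda>(t, s). f t s)"
    and f_zero: "\<forall>t\<in>{a..b}. f t 0 = 0"
    and beta_cont: "continuous_on {a..b} \<beta>"
    and beta_nonneg: "\<forall>t\<in>{a..b}. \<beta> t \<ge> 0"
    and f_lower: "\<forall>t\<in>{a..b}. \<forall>s\<ge>0. f t s \<ge> - \<beta> t * s"
    and at_zero: "\<exists>m0 :: real \<Rightarrow> real.
          continuous_on {a..b} m0 \<and> (\<forall>t\<in>{a..b}. m0 t \<ge> 0) \<and> (\<exists>t\<in>{a..b}. m0 t \<noteq> 0) \<and>
          ((\<lambda>s. SUP t\<in>{a..b}. \<bar>(f t s + \<beta> t * s) / s - m0 t\<bar>) \<longlongrightarrow> 0) (at_right 0) \<and>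
          lambda1 a b \<beta> m0 < 1"
    and at_infinity: "\<exists>minf :: real \<Rightarrow> real.
          continuous_on {a..b} minf \<and>
          Limsup at_top (\<lambda>s. ereal (SUP t\<in>{a..b}. f t s / s - minf t)) \<le> 0 \<and>
          mu1 a b (\<lambda>t. max (minf t) 0) > 1"
  shows "\<exists>u. positive_solution a b f u \<and> max_norm a b (deriv_on a b u) < 1"
proof -
  \<comment> \<open>extension by \<open>f t 0 = 0\<close> to negative values\<close>
  define g where "g = (\<lambda>t s. f t (max s 0))"
  interpret action_functional a b g
  proof
    have "continuous_on ({a..b} \<times> UNIV) (\<lambda>x. (\<lambda>(t, s). f t s) (fst x, max (snd x) 0))"
      by (rule continuous_on_compose2[OF f_cont]) (auto intro!: continuous_intros)
    then show "continuous_on ({a..b} \<times> UNIV) (\<lambda>(t, s). g t s)"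
      by (simp add: g_def case_prod_beta)
  qed (rule ab)
  obtain m0 where m0: "continuous_on {a..b} m0" "\<And>t. t \<in> {a..b} \<Longrightarrow> 0 \<le> m0 t"
    and lim: "((\<lambda>s. SUP t\<in>{a..b}. \<bar>(f t s + \<beta> t * s) / s - m0 t\<bar>) \<longlongrightarrow> 0) (at_right 0)"
    and lam: "lambda1 a b \<beta> m0 < 1"
    using at_zero by blast
  obtain l where l: "is_eigenvalue a b \<beta> m0 l" "l < 1"
    using lam unfolding lambda1_def principal_eigenvalue_def Inf_less_iff
    by (auto simp: one_ereal_def)
  let ?c = "\<lambda>t. m0 t - \<beta> t"
  have c: "continuous_on {a..b} ?c" by (intro continuous_intros m0 beta_cont)
  obtain e where e: "C1_on a b e" "e b = 0"
    "integral {a..b} (\<lambda>t. (deriv_on a b e t)\<^sup>2 - ?c t * (e t)\<^sup>2) < 0"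
    using eigenfunction_negative_energy[OF ab beta_cont _ m0 l] beta_nonneg by blast
  obtain v v' where v: "\<And>t. t \<in> {a..b} \<Longrightarrow> (v has_real_derivative v' t) (at t within {a..b})"
    "continuous_on {a..b} v'" "v b = 0" "\<And>t. 0 \<le> v t"
    "integral {a..b} (\<lambda>t. (v' t)\<^sup>2 - ?c t * (v t)\<^sup>2) < 0"
    by (rule nonneg_negative_energy[OF ab c e]) blast
  have lower: "\<forall>\<^sub>F s in at_right 0. \<forall>t\<in>{a..b}. (?c t - \<kappa>) * s \<le> g t s" if \<kappa>: "\<kappa> > 0" for \<kappa>
    using order_tendstoD(2)[OF lim \<kappa>] eventually_at_right_less[of 0]
  proof eventually_elim
    case (elim s)
    show ?case
    proof
      fix t assume t: "t \<in> {a..b}"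
      let ?r = "\<lambda>t. \<bar>(f t s + \<beta> t * s) / s - m0 t\<bar>"
      have "continuous_on {a..b} (\<lambda>t. g t s)" by (intro continuous_intros) auto
      then have "continuous_on {a..b} (\<lambda>t. f t s)" using elim(2) by (simp add: g_def max_def)
      then have "continuous_on {a..b} ?r" using elim(2) by (intro continuous_intros m0 beta_cont) auto
      then have "bdd_above (?r ` {a..b})"
        by (intro bounded_imp_bdd_above compact_imp_bounded compact_continuous_image) auto
      then have "?r t \<le> (SUP t\<in>{a..b}. ?r t)" by (rule cSUP_upper[OF t])
      then have "?r t < \<kappa>" using elim(1) by linarith
      then have "m0 t - \<kappa> \<le> (f t s + \<beta> t * s) / s" by (simp add: abs_less_iff)
      then have "(m0 t - \<kappa>) * s \<le> f t s + \<beta> t * s" using elim(2) by (simp add: pos_le_divide_eq)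
      then show "(?c t - \<kappa>) * s \<le> g t s" using elim(2) by (simp add: g_def max_def algebra_simps)
    qed
  qed
  obtain p where p: "admissible p" "action p < 0"
    using exists_negative_action[OF c lower v(1-4,5)] by blast
  obtain u where u: "continuous_on {a..b} u" "\<And>t. t \<in> {a..b} \<Longrightarrow> u t = prim b (response u) t"
    and nz: "\<exists>t\<in>{a..b}. u t \<noteq> 0"
    using exists_nontrivial_critical_point[OF p] by blast
  have sol: "is_solution a b g u" by (rule fixed_point_is_solution[OF u])
  have "g t s = 0" if "t \<in> {a..b}" "s \<le> 0" for t s
    using that f_zero by (simp add: g_def max_def)
  then have u0: "0 \<le> u t" if "t \<in> {a..b}" for t
    using fixed_point_nonneg[OF u] that by blast
  then have "is_solution a b f u"
    using sol by (auto simp: is_solution_def g_def max_absorb1)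
  obtain B where B: "B > 0" "\<And>t. t \<in> {a..b} \<Longrightarrow> \<bar>\<beta> t\<bar> \<le> B"
    using compact_imp_bounded[OF compact_continuous_image[OF beta_cont compact_Icc]]
    unfolding bounded_pos by auto
  have g_ge: "- B * s \<le> g t s" if t: "t \<in> {a..b}" and s: "0 \<le> s" for t s
  proof -
    have "\<beta> t * s \<le> B * s" using B(2)[OF t] s by (intro mult_right_mono) auto
    then show ?thesis using f_lower t s by (force simp: g_def max_def)
  qed
  have "0 < u s" if "s \<in> {a..<b}" for s
  proof (rule ccontr)
    assume "\<not> 0 < u s"
    then have "u s = 0" using u0[of s] that by simp
    then have "u t = 0" if "t \<in> {a..b}" for t
      using fixed_point_zero[OF u u0 g_ge, of s t] B(1) \<open>s \<in> {a..<b}\<close> that by simp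
    then show False using nz by blast
  qed
  then have "positive_solution a b f u"
    using \<open>is_solution a b f u\<close> by (simp add: positive_solution_def is_solution_def)
  then show ?thesis by (auto simp: positive_solution_def is_solution_def)
qed

end
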